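(* Let $\kappa$ be an infinite cardinal and let $\mathbf X=(X,\mathcal E)$ be a coarse space. The rank-$\kappa$ Roe-like $C^*$-algebras of $\mathbf X$ are defined (that is, $\mathbf X$ admits a $\kappa$-ample discrete $\mathbf X$-module of rank $\kappa$) if and only if $\mathbf X$ has coarse cardinality at most $\kappa$.
   Context: For relations $E,F\subseteq X\times X$: $E^T=\{(x,y):(y,x)\in E\}$, $E\circ F=\{(z,x):\exists y,(z,y)\in E,(y,x)\in F\}$, $E(A)=\{y:\exists a\in A,(y,a)\in E\}$. A coarse structure on $X$ is a non-empty family $\mathcal E$ of subsets of $X\times X$, closed under subsets and finite unions, containing the diagonal $\Delta_X$, and closed under $E\mapsto E^T$ and composition; $(X,\mathcal E)$ is a coarse space. A gauge is a symmetric element of $\mathcal E$ containing $\Delta_X$. $A\subseteq X$ is $E$-bounded if $A\times A\subseteq E$. $A\subseteq X$ is coarsely dense if $X=E(A)$ for some $E\in\mathcal E$. Coarse spaces $(X,\mathcal E)$, $(Y,\mathcal F)$ are coarsely equivalent if there are functions $f\colon X\to Y$, $g\colon Y\to X$ with $(f\times f)(E)\in\mathcal F$ and $(g\times g)(F)\in\mathcal E$ for all $E\in\mathcal E$, $F\in\mathcal F$, and $\{(g(f(x)),x):x\in X\}\in\mathcal E$, $\{(f(g(y)),y):y\in Y\}\in\mathcal F$. The coarse cardinality of $\mathbf X$ is the least cardinal $|Y|$ over all coarse spaces $(Y,\mathcal F)$ coarsely equivalent to $\mathbf X$. An $\mathbf X$-module consists of a Boolean algebra $\mathfrak A$ of subsets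 of $X$ with $X\in\mathfrak A$ (its members are called measurable), a Hilbert space $\mathcal H$, and a map $\mathbb 1_\bullet$ from $\mathfrak A$ to projections in $\mathcal B(\mathcal H)$ with $\mathbb 1_\emptyset=0$, $\mathbb 1_X=1$, $\mathbb 1_{A\cap B}=\mathbb 1_A\mathbb 1_B$, $\mathbb 1_{A\cup B}=\mathbb 1_A+\mathbb 1_B-\mathbb 1_A\mathbb 1_B$, non-degenerate: for some gauge $\widetilde E$ the subspaces $\mathbb 1_A(\mathcal H)$ with $A$ measurable and $\widetilde E$-bounded span a dense subspace. It is $\kappa$-ample if for some gauge $\widetilde E$ the union of all measurable $\widetilde E$-bounded $A$ with $\mathbb 1_A\neq0$ is coarsely dense and $\mathbb 1_A$ has rank at least $\kappa$ for each such $A$. The rank of a Hilbert space (or module) is the cardinality of an orthonormal basis. The module is discrete if there are a gauge $\widetilde E$ and a partition $X=\bigsqcup_{i\in I}A_i$ into measurable $\widetilde E$-bounded sets with $\sum_i\mathbb 1_{A_i}=1$ strongly, and such that every $C\subseteq X$ with $C\cap A_i\in\mathfrak A$ for all $i$ is in $\mathfrak A$. The rank-$\kappa$ Roe-like $C^*$-algebras of $\mathbf X$ are, by definition, the Roe-like $C^*$-algebras ($C^*_{\mathrm{Roe}}$, $C^*_{\mathrm{cp}}$, $C^*_{\mathrm{ql}}$) of a $\kappa$-ample discrete $\mathbf X$-module of rank $\kappa$; they are said to be defined when such a module exists.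
   Formalization: The formal statement assumes that X is non-empty; for empty X the claim fails, since 1_X = 1_∅ = 0 forces the Hilbert space to be zero, of rank 0 rather than κ, although the coarse cardinality 0 is at most κ. *)

theory Defs
  imports "HOL-Analysis.Analysis" "HOL-Library.Function_Algebras"
begin

unbundle cardinal_syntax

section \<open>Coarse spaces\<close>

locale coarse_space =
  fixes X :: "'a set" and \<E> :: "('a \<times> 'a) set set"
  assumes nonempty: "\<E> \<noteq> {}"
    and on_carrier: "E \<in> \<E> \<Longrightarrow> E \<subseteq> X \<times> X"
    and subset_closed: "E \<in> \<E> \<Longrightarrow> F \<subseteq> E \<Longrightarrow> F \<in> \<E>"
    and union_closed: "E \<in> \<E> \<Longrightarrow> F \<in> \<E> \<Longrightarrow> E \<union> F \<in> \<E>"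
    and diagonal: "Id_on X \<in> \<E>"
    and converse_closed: "E \<in> \<E> \<Longrightarrow> E\<inverse> \<in> \<E>"
    and relcomp_closed: "E \<in> \<E> \<Longrightarrow> F \<in> \<E> \<Longrightarrow> E O F \<in> \<E>"
begin

definition gauge_rel :: "('a \<times> 'a) set \<Rightarrow> bool" where
  "gauge_rel E \<longleftrightarrow> E \<in> \<E> \<and> sym E \<and> Id_on X \<subseteq> E"

text \<open>\<open>E(A) = {y. \<exists>a\<in>A. (y, a) \<in> E}\<close> is the image of \<open>A\<close> under the converse of \<open>E\<close>.\<close>

definition coarsely_dense :: "'a set \<Rightarrow> bool" where
  "coarsely_dense A \<longleftrightarrow> A \<subseteq> X \<and> (\<exists>E\<in>\<E>. X = E\<inverse> `` A)"

end

definition rel_bounded :: "('a \<times> 'a) set \<Rightarrow> 'a set \<Rightarrow> bool" where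
  "rel_bounded E A \<longleftrightarrow> A \<times> A \<subseteq> E"

definition coarsely_equivalent ::
  "'a set \<Rightarrow> ('a \<times> 'a) set set \<Rightarrow> 'b set \<Rightarrow> ('b \<times> 'b) set set \<Rightarrow> bool" where
  "coarsely_equivalent X \<E> Y \<F> \<longleftrightarrow>
     (\<exists>f g. f \<in> X \<rightarrow> Y \<and> g \<in> Y \<rightarrow> X \<and>
        (\<forall>E\<in>\<E>. map_prod f f ` E \<in> \<F>) \<and> (\<forall>F\<in>\<F>. map_prod g g ` F \<in> \<E>) \<and>
        {(g (f x), x) | x. x \<in> X} \<in> \<E> \<and> {(f (g y), y) | y. y \<in> Y} \<in> \<F>)"

text \<open>
  The minimum defining the coarse cardinality ranges here over coarse spaces whose underlying
  set lives in the type of \<open>X\<close>. This is no restriction, since \<open>X\<close> itself is a candidate and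
  any set of cardinality at most \<open>|X|\<close> has a copy inside \<open>X\<close>; see
  \<open>coarse_cardinality_attained\<close> and \<open>coarse_cardinality_least\<close> below, the latter for
  coarse spaces over arbitrary types.
\<close>

definition coarse_cardinality :: "'a set \<Rightarrow> ('a \<times> 'a) set set \<Rightarrow> 'a rel" where
  "coarse_cardinality X \<E> =
     |SOME Y :: 'a set. (\<exists>\<F>. coarse_space Y \<F> \<and> coarsely_equivalent X \<E> Y \<F>) \<and>
        (\<forall>(Z :: 'a set) \<G>. coarse_space Z \<G> \<and> coarsely_equivalent X \<E> Z \<G> \<longrightarrow> |Y| \<le>o |Z| )|"

lemma coarsely_equivalent_refl:
  assumes "coarse_space X \<E>"
  shows "coarsely_equivalent X \<E> X \<E>"
proof -
  interpret coarse_space X \<E> by fact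
  have "{(x, x) | x. x \<in> X} = Id_on X" by auto
  then show ?thesis
    unfolding coarsely_equivalent_def using diagonal
    by (intro exI[of _ "\<lambda>x. x"]) (auto simp: map_prod_def)
qed

lemma coarse_cardinality_min:
  fixes X :: "'a set"
  assumes "coarse_space X \<E>"
  shows "\<exists>Y :: 'a set. coarse_cardinality X \<E> = |Y| \<and>
      (\<exists>\<F>. coarse_space Y \<F> \<and> coarsely_equivalent X \<E> Y \<F>) \<and>
      (\<forall>(Z :: 'a set) \<G>. coarse_space Z \<G> \<and> coarsely_equivalent X \<E> Z \<G> \<longrightarrow> |Y| \<le>o |Z| )"
proof -
  let ?S = "{Y :: 'a set. \<exists>\<F>. coarse_space Y \<F> \<and> coarsely_equivalent X \<E> Y \<F>}"
  have "X \<in> ?S" using assms coarsely_equivalent_refl by blast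
  then obtain r where r: "r \<in> card_of ` ?S" "\<forall>r'\<in>card_of ` ?S. r \<le>o r'"
    using exists_minim_Card_order[of "card_of ` ?S"] by (auto simp: card_of_Card_order)
  then obtain Y where Y: "Y \<in> ?S" "\<forall>Z\<in>?S. |Y| \<le>o |Z|" by auto
  let ?Q = "\<lambda>Y :: 'a set. (\<exists>\<F>. coarse_space Y \<F> \<and> coarsely_equivalent X \<E> Y \<F>) \<and>
        (\<forall>(Z :: 'a set) \<G>. coarse_space Z \<G> \<and> coarsely_equivalent X \<E> Z \<G> \<longrightarrow> |Y| \<le>o |Z| )"
  have "?Q Y" using Y by auto
  then have "?Q (SOME Y. ?Q Y)" by (rule someI[of ?Q])
  then show ?thesis unfolding coarse_cardinality_def by blast
qed

lemma coarse_cardinality_attained: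
  fixes X :: "'a set"
  assumes "coarse_space X \<E>"
  shows "\<exists>(Y :: 'a set) \<F>. coarse_space Y \<F> \<and> coarsely_equivalent X \<E> Y \<F> \<and>
           coarse_cardinality X \<E> = |Y|"
  using coarse_cardinality_min[OF assms] by blast

lemma coarse_space_transport:
  assumes "coarse_space Y \<F>" and h: "inj_on h Y"
  defines "\<G> \<equiv> (\<lambda>F. map_prod h h ` F) ` \<F>"
  shows "coarse_space (h ` Y) \<G>"
proof -
  interpret coarse_space Y \<F> by fact
  show ?thesis
  proof
    show "\<G> \<noteq> {}" using nonempty by (auto simp: \<G>_def)
  next
    fix E assume "E \<in> \<G>"
    then show "E \<subseteq> h ` Y \<times> h ` Y" using on_carrier by (fastforce simp: \<G>_def)
  next
    fix E F assume "E \<in> \<G>" "F \<subseteq> E"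
    then obtain E' where "E' \<in> \<F>" "F \<subseteq> map_prod h h ` E'" by (auto simp: \<G>_def)
    then obtain F' where "F' \<subseteq> E'" "F = map_prod h h ` F'" by (auto simp: subset_image_iff)
    then show "F \<in> \<G>" using subset_closed \<open>E' \<in> \<F>\<close> by (auto simp: \<G>_def)
  next
    fix E F assume "E \<in> \<G>" "F \<in> \<G>"
    then obtain E' F' where "E' \<in> \<F>" "F' \<in> \<F>" "E = map_prod h h ` E'" "F = map_prod h h ` F'"
      by (auto simp: \<G>_def)
    then show "E \<union> F \<in> \<G>" using union_closed
      by (auto simp: \<G>_def image_Un[symmetric])
  next
    have "Id_on (h ` Y) = map_prod h h ` Id_on Y" by force
    then show "Id_on (h ` Y) \<in> \<G>" using diagonal by (auto simp: \<G>_def)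
  next
    fix E assume "E \<in> \<G>"
    then obtain E' where E': "E' \<in> \<F>" "E = map_prod h h ` E'" by (auto simp: \<G>_def)
    have "E\<inverse> = map_prod h h ` (E'\<inverse>)" unfolding E'(2) by force
    then show "E\<inverse> \<in> \<G>" using converse_closed E' by (auto simp: \<G>_def)
  next
    fix E F assume "E \<in> \<G>" "F \<in> \<G>"
    then obtain E' F' where EF: "E' \<in> \<F>" "F' \<in> \<F>" "E = map_prod h h ` E'" "F = map_prod h h ` F'"
      by (auto simp: \<G>_def)
    have "E O F = map_prod h h ` (E' O F')"
    proof (intro equalityI subsetI)
      fix p assume "p \<in> E O F"
      then obtain a b b' c where *: "(a, b) \<in> E'" "(b', c) \<in> F'" "h b = h b'" "p = (h a, h c)"
        unfolding EF by auto
      then have "b = b'" using on_carrier EF h by (meson SigmaD1 SigmaD2 inj_onD subsetD)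
      then show "p \<in> map_prod h h ` (E' O F')" using * by force
    next
      fix p assume "p \<in> map_prod h h ` (E' O F')"
      then show "p \<in> E O F" unfolding EF by force
    qed
    then show "E O F \<in> \<G>" using relcomp_closed EF by (auto simp: \<G>_def)
  qed
qed

lemma coarsely_equivalent_transport:
  assumes "coarse_space Y \<F>" and h: "inj_on h Y" and eq: "coarsely_equivalent X \<E> Y \<F>"
  shows "coarsely_equivalent X \<E> (h ` Y) ((\<lambda>F. map_prod h h ` F) ` \<F>)"
proof -
  interpret coarse_space Y \<F> by fact
  obtain f g where f: "f \<in> X \<rightarrow> Y" and g: "g \<in> Y \<rightarrow> X"
    and fE: "\<forall>E\<in>\<E>. map_prod f f ` E \<in> \<F>" and gF: "\<forall>F\<in>\<F>. map_prod g g ` F \<in> \<E>"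
    and gf: "{(g (f x), x) | x. x \<in> X} \<in> \<E>" and fg: "{(f (g y), y) | y. y \<in> Y} \<in> \<F>"
    using eq unfolding coarsely_equivalent_def by blast
  define k where "k = inv_into Y h"
  have kh: "k (h y) = y" if "y \<in> Y" for y using h that by (simp add: k_def)
  have 1: "map_prod (h \<circ> f) (h \<circ> f) ` E \<in> (\<lambda>F. map_prod h h ` F) ` \<F>" if "E \<in> \<E>" for E
  proof -
    have "map_prod (h \<circ> f) (h \<circ> f) ` E = map_prod h h ` (map_prod f f ` E)" by force
    then show ?thesis using fE that by blast
  qed
  have 2: "map_prod (g \<circ> k) (g \<circ> k) ` (map_prod h h ` F) \<in> \<E>" if "F \<in> \<F>" for F
  proof -
    have "map_prod (g \<circ> k) (g \<circ> k) ` (map_prod h h ` F) = map_prod g g ` F"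
      unfolding image_image
    proof (intro image_cong refl)
      fix p assume "p \<in> F"
      then have "p \<in> Y \<times> Y" using on_carrier that by blast
      then show "map_prod (g \<circ> k) (g \<circ> k) (map_prod h h p) = map_prod g g p"
        using kh by auto
    qed
    then show ?thesis using gF that by simp
  qed
  have 3: "{((g \<circ> k) ((h \<circ> f) x), x) | x. x \<in> X} \<in> \<E>"
  proof -
    have "{((g \<circ> k) ((h \<circ> f) x), x) | x. x \<in> X} = {(g (f x), x) | x. x \<in> X}"
      using f kh by (force simp: Pi_iff)
    then show ?thesis using gf by simp
  qed
  have 4: "{((h \<circ> f) ((g \<circ> k) y), y) | y. y \<in> h ` Y} \<in> (\<lambda>F. map_prod h h ` F) ` \<F>"
  proof -
    have "{((h \<circ> f) ((g \<circ> k) y), y) | y. y \<in> h ` Y} = map_prod h h ` {(f (g y), y) | y. y \<in> Y}"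
      using kh by force
    then show ?thesis using fg by blast
  qed
  show ?thesis unfolding coarsely_equivalent_def
    using f g kh 1 2 3 4
    by (intro exI[of _ "h \<circ> f"] exI[of _ "g \<circ> k"] conjI) auto
qed

lemma coarse_cardinality_least:
  fixes X :: "'a set" and Y :: "'b set"
  assumes X: "coarse_space X \<E>" and Y: "coarse_space Y \<F>"
    and eq: "coarsely_equivalent X \<E> Y \<F>"
  shows "coarse_cardinality X \<E> \<le>o |Y|"
proof -
  obtain M :: "'a set" where M: "coarse_cardinality X \<E> = |M|"
    and min: "\<And>(Z :: 'a set) \<G>. coarse_space Z \<G> \<Longrightarrow> coarsely_equivalent X \<E> Z \<G> \<Longrightarrow> |M| \<le>o |Z|"
    using coarse_cardinality_min[OF X] by blast
  consider "|Y| \<le>o |X|" | "|X| \<le>o |Y|"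
    using ordLeq_total[OF card_of_Well_order card_of_Well_order] by blast
  then have "|M| \<le>o |Y|"
  proof cases
    case 1
    then obtain h where h: "inj_on h Y" "h ` Y \<subseteq> X" using card_of_ordLeq[of Y X] by auto
    have "|M| \<le>o |h ` Y|"
      using min[OF coarse_space_transport[OF Y h(1)] coarsely_equivalent_transport[OF Y h(1) eq]] .
    then show ?thesis using card_of_image ordLeq_transitive by blast
  next
    case 2
    then show ?thesis
      using min[OF X coarsely_equivalent_refl[OF X]] ordLeq_transitive by blast
  qed
  then show ?thesis using M by simp
qed

section \<open>Complex Hilbert spaces\<close>

text \<open>
  A Hilbert space is a linear subspace \<open>H\<close> of some ambient complex vector space, with an inner
  product that is only relevant on \<open>H\<close>. Working with carriers makes it possible to quantify
  over Hilbert spaces. The inner product is linear in the first argument.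
\<close>

locale complex_inner_space = vector_space scale
  for scale :: "complex \<Rightarrow> 'v :: ab_group_add \<Rightarrow> 'v" (infixr \<open>*\<^sub>s\<close> 75) +
  fixes H :: "'v set" and ip :: "'v \<Rightarrow> 'v \<Rightarrow> complex"
  assumes subspace_H: "subspace H"
    and ip_commute: "u \<in> H \<Longrightarrow> v \<in> H \<Longrightarrow> ip u v = cnj (ip v u)"
    and ip_add_left: "u \<in> H \<Longrightarrow> v \<in> H \<Longrightarrow> w \<in> H \<Longrightarrow> ip (u + v) w = ip u w + ip v w"
    and ip_scale_left: "u \<in> H \<Longrightarrow> w \<in> H \<Longrightarrow> ip (c *\<^sub>s u) w = c * ip u w"
    and ip_nonneg: "u \<in> H \<Longrightarrow> 0 \<le> Re (ip u u)"
    and ip_definite: "u \<in> H \<Longrightarrow> ip u u = 0 \<Longrightarrow> u = 0"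
begin

definition hnorm :: "'v \<Rightarrow> real" where
  "hnorm v = sqrt (Re (ip v v))"

text \<open>The value outside \<open>H\<close> only serves the total axioms of \<^locale>\<open>Metric_space\<close>.\<close>

definition hdist :: "'v \<Rightarrow> 'v \<Rightarrow> real" where
  "hdist u v = (if u \<in> H \<and> v \<in> H then hnorm (u - v) else 0)"

lemma ip_self_Im: "u \<in> H \<Longrightarrow> Im (ip u u) = 0"
  using arg_cong[OF ip_commute[of u u], of Im] by simp

lemma hnorm_eq_0: "u \<in> H \<Longrightarrow> hnorm u = 0 \<longleftrightarrow> u = 0"
proof
  assume u: "u \<in> H" "hnorm u = 0"
  then have "ip u u = 0" using ip_self_Im by (simp add: hnorm_def complex_eq_iff)
  then show "u = 0" using u ip_definite by blast
next
  assume "u \<in> H" "u = 0"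
  then show "hnorm u = 0" using ip_scale_left[of u u 0] by (simp add: hnorm_def)
qed

lemma Re_ip_expand:
  assumes u: "u \<in> H" and v: "v \<in> H"
  shows "Re (ip (u + of_real t *\<^sub>s v) (u + of_real t *\<^sub>s v))
           = Re (ip u u) + 2 * t * Re (ip u v) + t\<^sup>2 * Re (ip v v)"
proof -
  let ?w = "complex_of_real t *\<^sub>s v"
  have w: "?w \<in> H" using v subspace_H subspace_scale by blast
  then have s: "u + ?w \<in> H" using u subspace_H subspace_add by blast
  have r: "ip x (u + ?w) = ip x u + of_real t * ip x v" if "x \<in> H" for x
    using that u v w s ip_commute[of x "u + ?w"] ip_add_left[of u ?w x] ip_scale_left[of v x "of_real t"]
      ip_commute[of u x] ip_commute[of v x] by simp
  have "ip (u + ?w) (u + ?w) = ip u (u + ?w) + of_real t * ip v (u + ?w)"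
    using ip_add_left[of u ?w "u + ?w"] ip_scale_left[of v "u + ?w" "of_real t"] u v w s by simp
  also have "\<dots> = ip u u + of_real t * ip u v + of_real t * (ip v u + of_real t * ip v v)"
    using r u v by simp
  moreover have "Re (ip v u) = Re (ip u v)" using ip_commute[OF u v] by simp
  ultimately show ?thesis by (simp add: power2_eq_square algebra_simps)
qed

lemma Re_ip_le:
  assumes u: "u \<in> H" and v: "v \<in> H"
  shows "Re (ip u v) \<le> hnorm u * hnorm v"
proof (cases "v = 0")
  case True
  have "ip v u = 0" using ip_scale_left[of v u 0] u v True by simp
  then have "ip u v = 0" using ip_commute[OF u v] by simp
  then show ?thesis using ip_nonneg u v by (simp add: hnorm_def)
next
  case False
  define a r b where "a = Re (ip u u)" and "r = Re (ip u v)" and "b = Re (ip v v)"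
  have "hnorm v \<noteq> 0" using False v hnorm_eq_0 by blast
  then have b: "b > 0" using ip_nonneg[OF v] by (simp add: hnorm_def b_def)
  have "u + of_real t *\<^sub>s v \<in> H" for t
    using u v subspace_H subspace_scale subspace_add by blast
  then have "0 \<le> a + 2 * (- r / b) * r + (- r / b)\<^sup>2 * b"
    using Re_ip_expand[OF u v, of "- r / b"] ip_nonneg unfolding a_def r_def b_def by metis
  then have "r\<^sup>2 \<le> a * b" using b by (simp add: power2_eq_square field_simps)
  then have "r \<le> sqrt (a * b)" by (rule real_le_rsqrt)
  then show ?thesis by (simp add: hnorm_def real_sqrt_mult a_def r_def b_def)
qed

lemma hnorm_triangle:
  assumes u: "u \<in> H" and v: "v \<in> H"
  shows "hnorm (u + v) \<le> hnorm u + hnorm v"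
proof -
  have sq: "(hnorm x)\<^sup>2 = Re (ip x x)" if "x \<in> H" for x
    using ip_nonneg[OF that] by (simp add: hnorm_def)
  have "u + v \<in> H" using u v subspace_H subspace_add by blast
  then have "(hnorm (u + v))\<^sup>2 = (hnorm u)\<^sup>2 + 2 * Re (ip u v) + (hnorm v)\<^sup>2"
    using Re_ip_expand[OF u v, of 1] u v by (simp add: sq)
  also have "\<dots> \<le> (hnorm u + hnorm v)\<^sup>2"
    using Re_ip_le[OF u v] by (simp add: power2_sum)
  finally show ?thesis
    by (rule power2_le_imp_le) (use u v ip_nonneg in \<open>simp add: hnorm_def\<close>)
qed

lemma hnorm_uminus: "u \<in> H \<Longrightarrow> hnorm (- u) = hnorm u"
proof -
  assume u: "u \<in> H"
  then have m: "- u \<in> H" using subspace_H subspace_neg by blast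
  have "ip (- u) x = - ip u x" if "x \<in> H" for x
    using ip_scale_left[OF u that, of "-1"] by simp
  then have "ip (- u) (- u) = ip u u"
    using u m ip_commute[of u "- u"] ip_self_Im[OF u] by (simp add: complex_eq_iff)
  then show ?thesis by (simp add: hnorm_def)
qed

end

sublocale complex_inner_space \<subseteq> Metric_space H hdist
proof
  have diff: "u - v \<in> H" if "u \<in> H" "v \<in> H" for u v
    using that subspace_H subspace_diff by blast
  show "0 \<le> hdist u v" for u v
    using ip_nonneg diff by (simp add: hdist_def hnorm_def)
  show "hdist u v = hdist v u" for u v
    using hnorm_uminus[OF diff, of u v] by (simp add: hdist_def)
  show "hdist u v = 0 \<longleftrightarrow> u = v" if "u \<in> H" "v \<in> H" for u v
    using that hnorm_eq_0[OF diff] by (simp add: hdist_def)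
  show "hdist u w \<le> hdist u v + hdist v w" if "u \<in> H" "v \<in> H" "w \<in> H" for u v w
    using that hnorm_triangle[OF diff diff, of u v v w] by (simp add: hdist_def)
qed

locale complex_hilbert_space = complex_inner_space scale H ip
  for scale :: "complex \<Rightarrow> 'v :: ab_group_add \<Rightarrow> 'v" (infixr \<open>*\<^sub>s\<close> 75)
    and H :: "'v set" and ip :: "'v \<Rightarrow> 'v \<Rightarrow> complex" +
  assumes complete: mcomplete
begin

definition bounded_operator :: "('v \<Rightarrow> 'v) \<Rightarrow> bool" where
  "bounded_operator T \<longleftrightarrow> T \<in> H \<rightarrow> H \<and>
     (\<forall>u\<in>H. \<forall>v\<in>H. T (u + v) = T u + T v) \<and>
     (\<forall>c. \<forall>v\<in>H. T (c *\<^sub>s v) = c *\<^sub>s T v) \<and>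
     (\<exists>C. \<forall>v\<in>H. hnorm (T v) \<le> C * hnorm v)"

definition projection :: "('v \<Rightarrow> 'v) \<Rightarrow> bool" where
  "projection T \<longleftrightarrow> bounded_operator T \<and> (\<forall>v\<in>H. T (T v) = T v) \<and>
     (\<forall>u\<in>H. \<forall>v\<in>H. ip (T u) v = ip u (T v))"

definition orthonormal_basis :: "'v set \<Rightarrow> 'v set \<Rightarrow> bool" where
  "orthonormal_basis W B \<longleftrightarrow> B \<subseteq> W \<and>
     (\<forall>u\<in>B. \<forall>v\<in>B. ip u v = (if u = v then 1 else 0)) \<and>
     mtopology closure_of span B = W"

text \<open>
  The rank of a closed subspace is the cardinality of an orthonormal basis, as a relation
  because cardinals live in different types.
\<close>

definition has_rank :: "'v set \<Rightarrow> 'c rel \<Rightarrow> bool" where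
  "has_rank W r \<longleftrightarrow> (\<exists>B. orthonormal_basis W B \<and> (card_of B, r) \<in> ordIso)"

definition has_rank_at_least :: "'v set \<Rightarrow> 'c rel \<Rightarrow> bool" where
  "has_rank_at_least W r \<longleftrightarrow> (\<exists>B. orthonormal_basis W B \<and> r \<le>o |B| )"

end

section \<open>Modules over coarse spaces\<close>

text \<open>
  Operators are compared on \<open>H\<close> only, and \<open>proj\<close> (written \<open>\<one>\<^sub>A\<close> in the literature) is
  irrelevant outside the algebra \<open>\<AA>\<close> of measurable sets.
\<close>

locale coarse_module = coarse_space X \<E> + complex_hilbert_space scale H ip
  for X :: "'a set" and \<E> :: "('a \<times> 'a) set set"
    and scale :: "complex \<Rightarrow> 'v :: ab_group_add \<Rightarrow> 'v" (infixr \<open>*\<^sub>s\<close> 75)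
    and H :: "'v set" and ip :: "'v \<Rightarrow> 'v \<Rightarrow> complex" +
  fixes \<AA> :: "'a set set" and proj :: "'a set \<Rightarrow> 'v \<Rightarrow> 'v"
  assumes boolean_algebra: "algebra X \<AA>"
    and proj_projection: "A \<in> \<AA> \<Longrightarrow> projection (proj A)"
    and proj_empty: "v \<in> H \<Longrightarrow> proj {} v = 0"
    and proj_space: "v \<in> H \<Longrightarrow> proj X v = v"
    and proj_Int: "A \<in> \<AA> \<Longrightarrow> B \<in> \<AA> \<Longrightarrow> v \<in> H \<Longrightarrow> proj (A \<inter> B) v = proj A (proj B v)"
    and proj_Un: "A \<in> \<AA> \<Longrightarrow> B \<in> \<AA> \<Longrightarrow> v \<in> H \<Longrightarrow>
      proj (A \<union> B) v = proj A v + proj B v - proj A (proj B v)"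
    and nondegenerate: "\<exists>E. gauge_rel E \<and>
      mtopology closure_of span (\<Union>A\<in>{A \<in> \<AA>. rel_bounded E A}. proj A ` H) = H"
begin

definition nonzero_bounded :: "('a \<times> 'a) set \<Rightarrow> 'a set set" where
  "nonzero_bounded E = {A \<in> \<AA>. rel_bounded E A \<and> (\<exists>v\<in>H. proj A v \<noteq> 0)}"

definition ample :: "'c rel \<Rightarrow> bool" where
  "ample \<kappa> \<longleftrightarrow> (\<exists>E. gauge_rel E \<and> coarsely_dense (\<Union>(nonzero_bounded E)) \<and>
     (\<forall>A\<in>nonzero_bounded E. has_rank_at_least (proj A ` H) \<kappa>))"

definition discrete :: bool where
  "discrete \<longleftrightarrow> (\<exists>E P. gauge_rel E \<and> partition_on X P \<and> P \<subseteq> \<AA> \<and>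
     (\<forall>A\<in>P. rel_bounded E A) \<and>
     (\<forall>v\<in>H. limitin mtopology (\<lambda>F. \<Sum>A\<in>F. proj A v) v (finite_subsets_at_top P)) \<and>
     (\<forall>C\<subseteq>X. (\<forall>A\<in>P. C \<inter> A \<in> \<AA>) \<longrightarrow> C \<in> \<AA>))"

end

text \<open>
  The rank-\<open>\<kappa>\<close> Roe-like C*-algebras are defined if there is a \<open>\<kappa>\<close>-ample discrete module of rank
  \<open>\<kappa>\<close>. The first argument fixes the type in which the carrier of the Hilbert space
  is sought. If \<open>\<kappa>\<close> is a
  cardinal on the type \<open>'k\<close>, then every Hilbert space of rank \<open>\<kappa>\<close> is isomorphic to one with
  carrier inside \<open>'k \<Rightarrow> complex\<close>, namely the square-summable functions supported on \<open>Field \<kappa>\<close>,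
  so that type loses no generality.
\<close>

definition roe_like_algebras_defined ::
  "'v :: ab_group_add itself \<Rightarrow> 'k rel \<Rightarrow> 'a set \<Rightarrow> ('a \<times> 'a) set set \<Rightarrow> bool" where
  "roe_like_algebras_defined (_ :: 'v itself) \<kappa> X \<E> \<longleftrightarrow>
     (\<exists>scale (H :: 'v set) ip \<AA> proj.
        coarse_module X \<E> scale H ip \<AA> proj \<and>
        coarse_module.ample X \<E> scale H ip \<AA> proj \<kappa> \<and>
        coarse_module.discrete X \<E> H ip \<AA> proj \<and>
        complex_hilbert_space.has_rank scale H ip H \<kappa>)"

end

theory Submission
  imports Defs "HOL-Library.Countable_Set_Type"
begin

text \<open>
  Let a discrete ample module of rank \<open>\<kappa>\<close> be given. Every vector is the sum of its components in the
  blocks of the partition, so only countably many of them are nonzero; applied to an orthonormal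
  basis this shows that at most \<open>\<kappa>\<close> blocks carry a nonzero projection. By ampleness, points chosen
  from these blocks form a coarsely dense set, which is coarsely equivalent to \<open>X\<close>.

  Conversely, a coarse equivalence with a set of size at most \<open>\<kappa>\<close> gives a map \<open>h\<close> on \<open>X\<close> close to
  the identity whose image has size at most \<open>\<kappa>\<close>. Choose a surjection \<open>t\<close> from \<open>Field \<kappa>\<close> onto this
  image all of whose fibres have size \<open>\<kappa>\<close>, and let \<open>A \<subseteq> X\<close> act on the square-summable functions on
  \<open>Field \<kappa>\<close> as multiplication by the indicator function of \<open>t -` A\<close>. The partition into the fibres of \<open>h\<close>
  shows that this module is discrete.
\<close>

section \<open>Modules bound the coarse cardinality\<close>

text \<open>Density supplies \<open>f\<close> sending every point of \<open>X\<close> to an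
  \<open>E\<close>-close point of \<open>D\<close>; the inclusion goes back. Both composites are
  close to the identity, and moving both coordinates of a controlled \<open>F\<close> along
  \<open>f\<close> stays inside \<open>E\<inverse> O F O E\<close>.\<close>

lemma (in coarse_space) coarsely_equivalent_restrict:
  assumes "coarsely_dense D"
  shows "coarse_space D {E \<in> \<E>. E \<subseteq> D \<times> D}"
    and "coarsely_equivalent X \<E> D {E \<in> \<E>. E \<subseteq> D \<times> D}"
proof -
  from assms obtain E where D: "D \<subseteq> X" and E: "E \<in> \<E>" "X = E\<inverse> `` D"
    by (auto simp: coarsely_dense_def)
  have "{} \<in> \<E>" using subset_closed[OF diagonal] by blast
  moreover have "Id_on D \<in> \<E>" using D by (intro subset_closed[OF diagonal]) auto
  ultimately show "coarse_space D {E \<in> \<E>. E \<subseteq> D \<times> D}"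
    by unfold_locales
      (auto intro: union_closed converse_closed relcomp_closed subset_closed)
  have "\<exists>d\<in>D. (x, d) \<in> E" if "x \<in> X" for x using that E by blast
  then obtain f where f: "\<And>x. x \<in> X \<Longrightarrow> f x \<in> D \<and> (x, f x) \<in> E" by metis
  have img: "map_prod f f ` F \<in> {E \<in> \<E>. E \<subseteq> D \<times> D}" if F: "F \<in> \<E>" for F
  proof -
    have sub: "map_prod f f ` F \<subseteq> (E\<inverse> O F) O E" "map_prod f f ` F \<subseteq> D \<times> D"
      using f on_carrier[OF F] by fastforce+
    have "(E\<inverse> O F) O E \<in> \<E>"
      using E F by (intro relcomp_closed converse_closed)
    then show ?thesis using sub subset_closed by blast
  qed
  have close: "{(f x, x) | x. x \<in> S} \<in> \<E>" if "S \<subseteq> X" for S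
    using f that by (intro subset_closed[OF converse_closed[OF E(1)]]) auto
  show "coarsely_equivalent X \<E> D {E \<in> \<E>. E \<subseteq> D \<times> D}"
    unfolding coarsely_equivalent_def
  proof (intro exI conjI)
    show "f \<in> X \<rightarrow> D" using f by blast
    show "(\<lambda>x. x) \<in> D \<rightarrow> X" using D by blast
    show "\<forall>E\<in>\<E>. map_prod f f ` E \<in> {E \<in> \<E>. E \<subseteq> D \<times> D}" using img by blast
    show "\<forall>F\<in>{E \<in> \<E>. E \<subseteq> D \<times> D}. map_prod (\<lambda>x. x) (\<lambda>x. x) ` F \<in> \<E>"
      by (simp add: map_prod_def)
    show "{(f x, x) | x. x \<in> X} \<in> \<E>" using close by blast
    show "{(f y, y) | y. y \<in> D} \<in> {E \<in> \<E>. E \<subseteq> D \<times> D}" using close[OF D] f D by auto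
  qed
qed

lemma (in coarse_space) coarse_cardinality_le_dense:
  assumes "coarsely_dense D"
  shows "coarse_cardinality X \<E> \<le>o |D|"
  using coarse_cardinality_least[OF coarse_space_axioms coarsely_equivalent_restrict[OF assms]] .

text \<open>The kernel of \<open>T\<close> is a linear subspace, so it contains the span of
  \<open>S\<close>, and boundedness extends the vanishing to the closure. With \<open>S\<close> an
  orthonormal basis, a nonzero block projection must be nonzero on some basis vector.\<close>

lemma (in complex_hilbert_space) bounded_operator_vanishes:
  assumes T: "bounded_operator T" and S: "S \<subseteq> H" and 0: "\<And>b. b \<in> S \<Longrightarrow> T b = 0"
    and v: "v \<in> mtopology closure_of span S"
  shows "T v = 0"
proof -
  have T0: "T 0 = 0"
  proof -
    have "0 \<in> H" using subspace_H subspace_0 by blast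
    then have "T (0 + 0) = T 0 + T 0" using T unfolding bounded_operator_def by blast
    then show ?thesis by simp
  qed
  have sub: "subspace {u \<in> H. T u = 0}"
    using T subspace_H T0 by (auto simp: subspace_def bounded_operator_def)
  have span: "u \<in> H \<and> T u = 0" if "u \<in> span S" for u
    using span_minimal[OF _ sub, of S] S 0 that by blast
  have vH: "v \<in> H" using v by (simp add: metric_closure_of)
  obtain C where C: "\<And>u. u \<in> H \<Longrightarrow> hnorm (T u) \<le> C * hnorm u"
    using T unfolding bounded_operator_def by blast
  have TvH: "T v \<in> H" using T vH unfolding bounded_operator_def by blast
  have "hnorm (T v) \<le> \<epsilon>" if "\<epsilon> > 0" for \<epsilon>
  proof -
    \<comment> \<open>The constant \<open>C\<close> may be zero or negative, so the denominator is
      made strictly positive.\<close>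
    have "\<epsilon> / (\<bar>C\<bar> + 1) > 0" using that by (simp add: add_nonneg_pos)
    then obtain u where u: "u \<in> span S" "hdist v u < \<epsilon> / (\<bar>C\<bar> + 1)"
      using v unfolding metric_closure_of in_mball by blast
    have uH: "u \<in> H" and Tu: "T u = 0" using span u by auto
    have dH: "v - u \<in> H" using vH uH subspace_H subspace_diff by blast
    have "T (v - u + u) = T (v - u) + T u"
      using T dH uH unfolding bounded_operator_def by blast
    then have "T v = T (v - u)" using Tu by simp
    then have "hnorm (T v) \<le> C * hnorm (v - u)" using C[OF dH] by simp
    also have "\<dots> \<le> (\<bar>C\<bar> + 1) * hdist v u"
      using vH uH ip_nonneg[OF dH] by (auto simp: hdist_def hnorm_def intro!: mult_right_mono)
    also have "\<dots> \<le> \<epsilon>" using u by (simp add: field_simps)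
    finally show ?thesis .
  qed
  then have "hnorm (T v) \<le> 0" by (rule field_le_epsilon[of _ 0, simplified])
  moreover have "hnorm (T v) \<ge> 0" using ip_nonneg[OF TvH] by (simp add: hnorm_def)
  ultimately show ?thesis using hnorm_eq_0[OF TvH] by simp
qed

text \<open>Adding one more index to a finite partial sum that is already close to the limit changes
  it by little, so an index outside countably many such partial sums carries the value 0.\<close>

lemma (in complex_inner_space) countable_support_of_convergent_sum:
  assumes lim: "limitin mtopology (\<lambda>F. \<Sum>i\<in>F. w i) v (finite_subsets_at_top P)"
    and w: "\<And>i. i \<in> P \<Longrightarrow> w i \<in> H"
  shows "countable {i \<in> P. w i \<noteq> 0}"
proof -
  have "\<exists>F. finite F \<and> F \<subseteq> P \<and> (\<forall>G. finite G \<and> F \<subseteq> G \<and> G \<subseteq> P \<longrightarrow>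
      (\<Sum>i\<in>G. w i) \<in> H \<and> hdist (\<Sum>i\<in>G. w i) v < 1 / Suc n)" for n
  proof -
    have "0 < 1 / real (Suc n)" by simp
    then show ?thesis
      using lim unfolding limitin_metric eventually_finite_subsets_at_top by blast
  qed
  then obtain F where F: "\<And>n. finite (F n)" "\<And>n. F n \<subseteq> P"
    and close: "\<And>n G. finite G \<Longrightarrow> F n \<subseteq> G \<Longrightarrow> G \<subseteq> P \<Longrightarrow>
      (\<Sum>i\<in>G. w i) \<in> H \<and> hdist (\<Sum>i\<in>G. w i) v < 1 / Suc n"
    by metis
  have vH: "v \<in> H" using lim by (simp add: limitin_metric)
  have "{i \<in> P. w i \<noteq> 0} \<subseteq> (\<Union>n. F n)"
  proof (intro subsetI, rule ccontr)
    fix i assume i: "i \<in> {i \<in> P. w i \<noteq> 0}" "i \<notin> (\<Union>n. F n)"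
    have bound: "hnorm (w i) \<le> 2 / Suc n" for n
    proof -
      let ?s = "\<Sum>j\<in>F n. w j" and ?t = "\<Sum>j\<in>insert i (F n). w j"
      have s: "?s \<in> H" "hdist ?s v < 1 / Suc n" using close[of "F n" n] F by auto
      have t: "?t \<in> H" "hdist ?t v < 1 / Suc n" using close[of "insert i (F n)" n] F i by auto
      have "hnorm (w i) = hdist ?t ?s" using s t i F by (simp add: hdist_def)
      also have "\<dots> \<le> hdist ?t v + hdist v ?s" using triangle[OF t(1) vH s(1)] .
      also have "\<dots> \<le> 2 / Suc n" using s t commute[of v ?s] by simp
      finally show ?thesis .
    qed
    have "(\<lambda>n. 2 / real (Suc n)) \<longlonglongrightarrow> 0"
      using tendsto_mult_right[OF LIMSEQ_inverse_real_of_nat, of 2] by (simp add: divide_inverse)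
    then have "hnorm (w i) \<le> 0" by (rule LIMSEQ_le_const) (use bound in auto)
    moreover have "hnorm (w i) \<ge> 0" using ip_nonneg w i by (simp add: hnorm_def)
    ultimately show False using hnorm_eq_0[of "w i"] w i by auto
  qed
  then show ?thesis by (rule countable_subset) (simp add: F(1) countable_finite)
qed

section \<open>Blocks of the partition that carry a nonzero projection\<close>

context coarse_module
begin

lemma proj_closed: "A \<in> \<AA> \<Longrightarrow> v \<in> H \<Longrightarrow> proj A v \<in> H"
  using proj_projection[of A] unfolding projection_def bounded_operator_def by blast

text \<open>A nonzero block is detected by some basis vector, and each basis vector detects only
  countably many blocks. A union of at most \<kappa> countable sets has size at most \<kappa>, since
  \<kappa> is infinite.\<close>

lemma card_nonzero_blocks_le:
  assumes inf: "Cinfinite \<kappa>" and rank: "has_rank H \<kappa>" and P: "P \<subseteq> \<AA>"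
    and lim: "\<And>v. v \<in> H \<Longrightarrow>
      limitin mtopology (\<lambda>F. \<Sum>A\<in>F. proj A v) v (finite_subsets_at_top P)"
  shows "|{A \<in> P. \<exists>v\<in>H. proj A v \<noteq> 0}| \<le>o \<kappa>"
proof -
  from rank obtain B where B: "orthonormal_basis H B" and card: "|B| =o \<kappa>"
    by (auto simp: has_rank_def)
  have BH: "B \<subseteq> H" and dense: "mtopology closure_of span B = H"
    using B unfolding orthonormal_basis_def by blast+
  have "proj A v = 0" if "A \<in> P" "v \<in> H" "\<And>b. b \<in> B \<Longrightarrow> proj A b = 0" for A v
  proof (rule bounded_operator_vanishes[OF _ BH that(3)])
    show "bounded_operator (proj A)" using proj_projection P that(1) unfolding projection_def by blast
    show "v \<in> mtopology closure_of span B" using that(2) dense by metis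
  qed
  then have "{A \<in> P. \<exists>v\<in>H. proj A v \<noteq> 0} \<subseteq> (\<Union>b\<in>B. {A \<in> P. proj A b \<noteq> 0})" by blast
  moreover have "|\<Union>b\<in>B. {A \<in> P. proj A b \<noteq> 0}| \<le>o \<kappa>"
  proof (rule card_of_UNION_ordLeq_infinite_Field)
    show "\<not> finite (Field \<kappa>)" "Card_order \<kappa>" using inf by (auto simp: cinfinite_def)
    show "|B| \<le>o \<kappa>" using card ordIso_imp_ordLeq by blast
    show "\<forall>b\<in>B. |{A \<in> P. proj A b \<noteq> 0}| \<le>o \<kappa>"
    proof
      fix b assume b: "b \<in> B"
      have "countable {A \<in> P. proj A b \<noteq> 0}"
        using countable_support_of_convergent_sum[OF lim, of b] b BH P proj_closed by blast
      then have "|{A \<in> P. proj A b \<noteq> 0}| \<le>o natLeq"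
        using countable_card_le_natLeq by blast
      then show "|{A \<in> P. proj A b \<noteq> 0}| \<le>o \<kappa>"
        using natLeq_ordLeq_cinfinite[OF inf] ordLeq_transitive by blast
    qed
  qed
  ultimately show ?thesis using card_of_mono1 ordLeq_transitive by blast
qed

text \<open>By ampleness, \<open>x\<close> is \<open>F\<close>-close to a point \<open>a\<close> of
  a \<open>G\<close>-bounded set \<open>A\<close> with nonzero projection. Some block
  \<open>B\<close> with nonzero projection meets \<open>A\<close>, say in \<open>c\<close>, and the
  chain from \<open>x\<close> through \<open>a\<close> and \<open>c\<close> to \<open>y B\<close>
  lies in \<open>F O G O E\<close>, a relation independent of \<open>x\<close>.\<close>

lemma coarsely_dense_nonzero_blocks:
  assumes amp: "ample \<kappa>" and P: "P \<subseteq> \<AA>" and X: "\<Union>P = X"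
    and bounded: "E \<in> \<E>" "\<And>A. A \<in> P \<Longrightarrow> rel_bounded E A"
    and lim: "\<And>v. v \<in> H \<Longrightarrow>
      limitin mtopology (\<lambda>F. \<Sum>A\<in>F. proj A v) v (finite_subsets_at_top P)"
    and y: "\<And>A. A \<in> P \<Longrightarrow> y A \<in> A"
  shows "coarsely_dense (y ` {A \<in> P. \<exists>v\<in>H. proj A v \<noteq> 0})"
proof -
  from amp obtain G where G: "gauge_rel G" and dense: "coarsely_dense (\<Union>(nonzero_bounded G))"
    unfolding ample_def by blast
  obtain F where F: "F \<in> \<E>" and XF: "X = F\<inverse> `` (\<Union>(nonzero_bounded G))"
    using conjunct2[OF dense[unfolded coarsely_dense_def]] by (rule bexE)
  let ?D = "y ` {A \<in> P. \<exists>v\<in>H. proj A v \<noteq> 0}"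
  have DX: "?D \<subseteq> X" using y X by blast
  have GE: "G \<in> \<E>" using G by (simp add: gauge_rel_def)
  have R: "(F O G) O E \<in> \<E>" using F GE bounded(1) by (intro relcomp_closed)
  have "\<exists>d\<in>?D. (x, d) \<in> (F O G) O E" if x: "x \<in> X" for x
  proof -
    obtain A a where a: "(x, a) \<in> F" "a \<in> A" "A \<in> nonzero_bounded G"
      using subsetD[OF equalityD1[OF XF] x] by blast
    then obtain v where v: "v \<in> H" "proj A v \<noteq> 0" and A: "A \<in> \<AA>" "A \<times> A \<subseteq> G"
      by (auto simp: nonzero_bounded_def rel_bounded_def)
    have vA: "proj A v \<in> H" using proj_closed A v by blast
    \<comment> \<open>If all components of \<open>proj A v\<close> vanished, its partial sums would
      all be 0 and so would their limit, which is \<open>proj A v\<close> itself.\<close>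
    have "\<exists>B\<in>P. proj B (proj A v) \<noteq> 0"
    proof (rule ccontr)
      assume none: "\<not> (\<exists>B\<in>P. proj B (proj A v) \<noteq> 0)"
      have "hdist 0 (proj A v) < \<epsilon>" if "\<epsilon> > 0" for \<epsilon>
      proof -
        have "\<forall>\<^sub>F S in finite_subsets_at_top P. hdist (\<Sum>B\<in>S. proj B (proj A v)) (proj A v) < \<epsilon>"
          using lim[OF vA] that by (auto simp: limitin_metric elim: eventually_mono)
        then obtain S where "finite S" "S \<subseteq> P" "hdist (\<Sum>B\<in>S. proj B (proj A v)) (proj A v) < \<epsilon>"
          unfolding eventually_finite_subsets_at_top by blast
        moreover from this none have "(\<Sum>B\<in>S. proj B (proj A v)) = 0"
          by (intro sum.neutral) blast
        ultimately show ?thesis by simp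
      qed
      then have "hdist 0 (proj A v) \<le> 0" by (meson less_irrefl not_le)
      then have "hdist 0 (proj A v) = 0" using nonneg[of 0 "proj A v"] by linarith
      then show False using zero[of 0 "proj A v"] vA v subspace_H subspace_0 by auto
    qed
    then obtain B where B: "B \<in> P" "proj B (proj A v) \<noteq> 0" by blast
    \<comment> \<open>The composite of the two projections is the projection of the intersection,
      which would be 0 for disjoint sets.\<close>
    then have "A \<inter> B \<noteq> {}"
      using proj_Int[of B A v] proj_empty v A P by (metis Int_commute subsetD)
    then obtain c where c: "c \<in> A" "c \<in> B" by blast
    have "(a, c) \<in> G" using A a c by blast
    moreover have "(c, y B) \<in> E" using bounded(2)[OF B(1)] c y[OF B(1)] by (auto simp: rel_bounded_def)
    \<comment> \<open>The vector \<open>proj A v\<close> witnesses that the block \<open>B\<close>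
      is nonzero.\<close>
    moreover have "y B \<in> ?D" using B vA by blast
    ultimately show ?thesis using a by blast
  qed
  moreover have "(F O G) O E \<subseteq> X \<times> X" using on_carrier R by blast
  ultimately have "X = ((F O G) O E)\<inverse> `` ?D" by (intro equalityI) blast+
  with R DX show ?thesis unfolding coarsely_dense_def by (intro conjI bexI)
qed

lemma coarse_cardinality_le_rank:
  assumes "Cinfinite \<kappa>" and "ample \<kappa>" and "discrete" and "has_rank H \<kappa>"
  shows "coarse_cardinality X \<E> \<le>o \<kappa>"
proof -
  obtain E P where E: "gauge_rel E" and part: "partition_on X P" and P: "P \<subseteq> \<AA>"
    and bounded: "\<forall>A\<in>P. rel_bounded E A"
    and lim: "\<forall>v\<in>H. limitin mtopology (\<lambda>F. \<Sum>A\<in>F. proj A v) v (finite_subsets_at_top P)"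
    using \<open>discrete\<close> unfolding discrete_def by (elim exE conjE) (rule that)
  have "A \<noteq> {}" if "A \<in> P" for A using part that by (auto simp: partition_on_def)
  then obtain y where y: "\<And>A. A \<in> P \<Longrightarrow> y A \<in> A" by (metis ex_in_conv)
  let ?P = "{A \<in> P. \<exists>v\<in>H. proj A v \<noteq> 0}"
  have "coarsely_dense (y ` ?P)"
    using coarsely_dense_nonzero_blocks[OF \<open>ample \<kappa>\<close> P _ _ bspec[OF bounded] bspec[OF lim] y] E part
    by (auto simp: gauge_rel_def partition_on_def)
  then have "coarse_cardinality X \<E> \<le>o |y ` ?P|" by (rule coarse_cardinality_le_dense)
  also have "|y ` ?P| \<le>o |?P|" by (rule card_of_image)
  also have "|?P| \<le>o \<kappa>" using card_nonzero_blocks_le[OF assms(1,4) P bspec[OF lim]] .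
  finally show ?thesis .
qed

end

lemma coarse_cardinality_le_if_roe_like_algebras_defined:
  assumes "Cinfinite \<kappa>" and "roe_like_algebras_defined TYPE('v :: ab_group_add) \<kappa> X \<E>"
  shows "coarse_cardinality X \<E> \<le>o \<kappa>"
  using assms(2) coarse_module.coarse_cardinality_le_rank[OF _ assms(1)]
  unfolding roe_like_algebras_defined_def by blast


section \<open>Spaces of square-summable functions\<close>

text \<open>Extension by zero lets all these spaces share one type and one inner product, so that
  for \<open>S \<subseteq> T\<close> the space \<open>l2 S\<close> is literally a subspace of
  \<open>l2 T\<close>.\<close>

definition l2 :: "'k set \<Rightarrow> ('k \<Rightarrow> complex) set" where
  "l2 S = {f. (\<forall>k. k \<notin> S \<longrightarrow> f k = 0) \<and> (\<lambda>k. (cmod (f k))\<^sup>2) summable_on UNIV}"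

definition l2_ip :: "('k \<Rightarrow> complex) \<Rightarrow> ('k \<Rightarrow> complex) \<Rightarrow> complex" where
  "l2_ip u v = (\<Sum>\<^sub>\<infinity>k. u k * cnj (v k))"

definition sqnorm :: "('k \<Rightarrow> complex) \<Rightarrow> real" where
  "sqnorm f = (\<Sum>\<^sub>\<infinity>k. (cmod (f k))\<^sup>2)"

definition cscale :: "complex \<Rightarrow> ('k \<Rightarrow> complex) \<Rightarrow> 'k \<Rightarrow> complex" where
  "cscale c f = (\<lambda>k. c * f k)"

definition cutoff :: "'k set \<Rightarrow> ('k \<Rightarrow> complex) \<Rightarrow> 'k \<Rightarrow> complex" where
  "cutoff T f = (\<lambda>k. if k \<in> T then f k else 0)"

definition unit_fun :: "'k \<Rightarrow> 'k \<Rightarrow> complex" where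
  "unit_fun k = (\<lambda>j. if j = k then 1 else 0)"

lemma inj_unit_fun: "inj unit_fun"
  by (rule injI) (metis unit_fun_def zero_neq_one)

text \<open>For nonnegative terms, a uniform bound on finite partial sums gives summability and
  bounds the total. Norm estimates below thereby reduce to finite sums.\<close>

lemma l2I:
  assumes "\<And>k. k \<notin> S \<Longrightarrow> f k = 0"
    and le: "\<And>F. finite F \<Longrightarrow> (\<Sum>k\<in>F. (cmod (f k))\<^sup>2) \<le> C"
  shows "f \<in> l2 S" and "sqnorm f \<le> C"
proof -
  have *: "(\<lambda>k. (cmod (f k))\<^sup>2) summable_on UNIV"
    by (rule nonneg_bdd_above_summable_on) (auto intro!: bdd_aboveI le)
  then show "f \<in> l2 S" using assms by (simp add: l2_def)
  show "sqnorm f \<le> C" unfolding sqnorm_def using * le by (intro infsum_le_finite_sums) auto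
qed

lemma l2_finite_sum_le: "f \<in> l2 S \<Longrightarrow> finite F \<Longrightarrow> (\<Sum>k\<in>F. (cmod (f k))\<^sup>2) \<le> sqnorm f"
  unfolding sqnorm_def by (rule finite_sum_le_infsum) (auto simp: l2_def)

lemma l2_le_sqnorm: "f \<in> l2 S \<Longrightarrow> (cmod (f k))\<^sup>2 \<le> sqnorm f"
  using l2_finite_sum_le[of f S "{k}"] by simp

lemma sqnorm_nonneg: "sqnorm f \<ge> 0"
  unfolding sqnorm_def by (rule infsum_nonneg) simp

lemma l2_zero_outside: "f \<in> l2 S \<Longrightarrow> k \<notin> S \<Longrightarrow> f k = 0"
  by (simp add: l2_def)

lemma l2_mono: "S \<subseteq> T \<Longrightarrow> l2 S \<subseteq> l2 T"
  by (auto simp: l2_def)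

lemma cscale_apply [simp]: "cscale c f k = c * f k"
  by (simp add: cscale_def)

section \<open>Linear structure, inner product and completeness\<close>

interpretation cfun: vector_space cscale
  by unfold_locales (auto simp: fun_eq_iff algebra_simps)

lemma l2_add: assumes "u \<in> l2 S" "v \<in> l2 S" shows "u + v \<in> l2 S"
proof (rule l2I)
  show "(u + v) k = 0" if "k \<notin> S" for k using assms that by (simp add: l2_zero_outside)
  fix F :: "'a set" assume F: "finite F"
  have "(cmod (a + b))\<^sup>2 \<le> 2 * (cmod a)\<^sup>2 + 2 * (cmod b)\<^sup>2" for a b
  proof -
    have "(cmod (a + b))\<^sup>2 \<le> (cmod a + cmod b)\<^sup>2" by (intro power_mono norm_triangle_ineq) simp
    also have "\<dots> \<le> 2 * (cmod a)\<^sup>2 + 2 * (cmod b)\<^sup>2"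
      using sum_squares_bound[of "cmod a" "cmod b"] by (simp add: power2_sum)
    finally show ?thesis .
  qed
  then have "(\<Sum>k\<in>F. (cmod ((u + v) k))\<^sup>2) \<le> (\<Sum>k\<in>F. 2 * (cmod (u k))\<^sup>2 + 2 * (cmod (v k))\<^sup>2)"
    by (intro sum_mono) simp
  also have "\<dots> = 2 * (\<Sum>k\<in>F. (cmod (u k))\<^sup>2) + 2 * (\<Sum>k\<in>F. (cmod (v k))\<^sup>2)"
    by (simp add: sum.distrib sum_distrib_left)
  also have "\<dots> \<le> 2 * sqnorm u + 2 * sqnorm v"
    using assms F by (intro add_mono mult_left_mono l2_finite_sum_le) auto
  finally show "(\<Sum>k\<in>F. (cmod ((u + v) k))\<^sup>2) \<le> 2 * sqnorm u + 2 * sqnorm v" .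
qed

lemma l2_cscale: "u \<in> l2 S \<Longrightarrow> cscale c u \<in> l2 S"
  by (auto simp: l2_def norm_mult power_mult_distrib intro: summable_on_cmult_right)

lemma l2_zero: "0 \<in> l2 S"
  by (simp add: l2_def)

lemma l2_diff: assumes "u \<in> l2 S" "v \<in> l2 S" shows "u - v \<in> l2 S"
proof -
  have "u - v = u + cscale (-1) v" by (simp add: fun_eq_iff)
  then show ?thesis using assms l2_add l2_cscale by metis
qed

text \<open>The terms are dominated by the sum of the two squares, so the series converges
  absolutely.\<close>

lemma l2_mult_summable:
  assumes "u \<in> l2 S" "v \<in> l2 T"
  shows "(\<lambda>k. u k * cnj (v k)) summable_on UNIV"
proof -
  have sum: "(\<lambda>k. (cmod (u k))\<^sup>2 + (cmod (v k))\<^sup>2) summable_on UNIV"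
    using assms by (intro summable_on_add) (auto simp: l2_def)
  have le: "norm (u k * cnj (v k)) \<le> (cmod (u k))\<^sup>2 + (cmod (v k))\<^sup>2" for k
    using sum_squares_bound[of "cmod (u k)" "cmod (v k)"]
      mult_nonneg_nonneg[OF norm_ge_zero[of "u k"] norm_ge_zero[of "v k"]]
    unfolding norm_mult complex_mod_cnj by linarith
  show ?thesis
    by (rule Infinite_Sum.abs_summable_summable, rule Infinite_Sum.abs_summable_on_comparison_test'[OF sum]) (rule le)
qed

lemma l2_ip_self: assumes "u \<in> l2 S" shows "l2_ip u u = complex_of_real (sqnorm u)"
proof -
  have "((\<lambda>k. (cmod (u k))\<^sup>2) has_sum sqnorm u) UNIV"
    using assms unfolding sqnorm_def by (intro has_sum_infsum) (simp add: l2_def)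
  then have "((\<lambda>k. complex_of_real ((cmod (u k))\<^sup>2)) has_sum of_real (sqnorm u)) UNIV"
    by (rule has_sum_of_real)
  moreover have "complex_of_real ((cmod (u k))\<^sup>2) = u k * cnj (u k)" for k
    by (simp only: complex_norm_square)
  ultimately show ?thesis unfolding l2_ip_def using infsumI by fastforce
qed

lemma complex_inner_space_l2: "complex_inner_space cscale (l2 S) l2_ip"
proof (intro complex_inner_space.intro complex_inner_space_axioms.intro cfun.vector_space_axioms)
  show "cfun.subspace (l2 S)" by (simp add: cfun.subspace_def l2_zero l2_add l2_cscale)
  fix u v assume u: "u \<in> l2 S" and v: "v \<in> l2 S"
  show "l2_ip u v = cnj (l2_ip v u)"
    unfolding l2_ip_def infsum_cnj[symmetric] by (simp add: mult.commute)
  show "l2_ip (u + v) w = l2_ip u w + l2_ip v w" if "w \<in> l2 S" for w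
    using l2_mult_summable[OF u that] l2_mult_summable[OF v that]
    by (simp add: l2_ip_def infsum_add distrib_right)
  show "l2_ip (cscale c u) v = c * l2_ip u v" for c
    using l2_mult_summable[OF u v] by (simp add: l2_ip_def infsum_cmult_right mult.assoc)
  show "0 \<le> Re (l2_ip u u)" using l2_ip_self[OF u] sqnorm_nonneg by simp
  show "u = 0" if "l2_ip u u = 0"
    using that l2_ip_self[OF u] l2_le_sqnorm[OF u] by (auto simp: fun_eq_iff)
qed

abbreviation l2_dist :: "'k set \<Rightarrow> ('k \<Rightarrow> complex) \<Rightarrow> ('k \<Rightarrow> complex) \<Rightarrow> real" where
  "l2_dist S \<equiv> complex_inner_space.hdist (l2 S) l2_ip"

lemma l2_hnorm: "u \<in> l2 S \<Longrightarrow> complex_inner_space.hnorm l2_ip u = sqrt (sqnorm u)"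
  by (simp add: complex_inner_space.hnorm_def[OF complex_inner_space_l2] l2_ip_self)

lemma l2_hdist: "u \<in> l2 S \<Longrightarrow> v \<in> l2 S \<Longrightarrow>
    l2_dist S u v = sqrt (sqnorm (u - v))"
  by (simp add: complex_inner_space.hdist_def[OF complex_inner_space_l2] l2_hnorm[OF l2_diff])

text \<open>Evaluation at a point is 1-Lipschitz. This gives the coordinatewise limit in the
  completeness proof and shows that vanishing at \<open>k\<close> survives limits.\<close>

lemma norm_le_hdist:
  assumes "u \<in> l2 S" "v \<in> l2 S"
  shows "cmod (u k - v k) \<le> l2_dist S u v"
  using l2_le_sqnorm[OF l2_diff[OF assms], of k] by (simp add: l2_hdist[OF assms] real_le_rsqrt)

lemma complex_hilbert_space_l2: "complex_hilbert_space cscale (l2 S) l2_ip"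
proof (intro complex_hilbert_space.intro complex_inner_space_l2 complex_hilbert_space_axioms.intro)
  interpret complex_inner_space cscale "l2 S" l2_ip by (rule complex_inner_space_l2)
  let ?d = "l2_dist S"
  show mcomplete unfolding mcomplete_def
  proof (intro allI impI)
    fix \<sigma> assume MC: "MCauchy \<sigma>"
    have \<sigma>: "\<And>n. \<sigma> n \<in> l2 S"
      using conjunct1[OF MC[unfolded MCauchy_def]] by auto
    have cauchy: "\<exists>N. \<forall>n\<ge>N. \<forall>m\<ge>N. ?d (\<sigma> n) (\<sigma> m) < \<epsilon>" if "\<epsilon> > 0" for \<epsilon>
      using conjunct2[OF MC[unfolded MCauchy_def]] that by meson
    have "Cauchy (\<lambda>n. \<sigma> n k)" for k
      unfolding Cauchy_def dist_norm using cauchy norm_le_hdist[OF \<sigma> \<sigma>]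
      by (meson le_less_trans)
    then have "\<exists>L. (\<lambda>n. \<sigma> n k) \<longlonglongrightarrow> L" for k using Cauchy_convergent convergentD by blast
    then obtain L where L: "\<And>k. (\<lambda>n. \<sigma> n k) \<longlonglongrightarrow> L k" by metis
    have L0: "L k = 0" if "k \<notin> S" for k
      using L[of k] l2_zero_outside[OF \<sigma> that] by (simp add: LIMSEQ_const_iff)
    \<comment> \<open>The Cauchy estimate is restricted to a finite set \<open>F\<close> of
      coordinates, where \<open>m\<close> can tend to infinity; the resulting bound does not depend
      on \<open>F\<close>, so \<open>l2I\<close> applies.\<close>
    have tail: "\<exists>N. \<forall>n\<ge>N. \<sigma> n - L \<in> l2 S \<and> sqnorm (\<sigma> n - L) \<le> \<epsilon>\<^sup>2" if \<epsilon>: "\<epsilon> > 0" for \<epsilon>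
    proof -
      obtain N where N: "\<And>n m. n \<ge> N \<Longrightarrow> m \<ge> N \<Longrightarrow> ?d (\<sigma> n) (\<sigma> m) < \<epsilon>"
        using cauchy[OF \<epsilon>] by blast
      have bound: "(\<Sum>k\<in>F. (cmod ((\<sigma> n - L) k))\<^sup>2) \<le> \<epsilon>\<^sup>2" if n: "n \<ge> N" and F: "finite F" for n F
      proof (rule LIMSEQ_le_const2)
        show "(\<lambda>m. \<Sum>k\<in>F. (cmod (\<sigma> n k - \<sigma> m k))\<^sup>2) \<longlonglongrightarrow> (\<Sum>k\<in>F. (cmod ((\<sigma> n - L) k))\<^sup>2)"
          by (auto intro!: tendsto_intros L)
        have "(\<Sum>k\<in>F. (cmod (\<sigma> n k - \<sigma> m k))\<^sup>2) \<le> \<epsilon>\<^sup>2" if m: "m \<ge> N" for m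
        proof -
          have "(\<Sum>k\<in>F. (cmod ((\<sigma> n - \<sigma> m) k))\<^sup>2) \<le> sqnorm (\<sigma> n - \<sigma> m)"
            by (rule l2_finite_sum_le[OF l2_diff[OF \<sigma> \<sigma>] F])
          also have "\<dots> \<le> \<epsilon>\<^sup>2"
            using N[OF n m] l2_hdist[OF \<sigma> \<sigma>] sqrt_le_D by fastforce
          finally show ?thesis by simp
        qed
        then show "\<exists>N. \<forall>m\<ge>N. (\<Sum>k\<in>F. (cmod (\<sigma> n k - \<sigma> m k))\<^sup>2) \<le> \<epsilon>\<^sup>2" by blast
      qed
      have "(\<sigma> n - L) k = 0" if "k \<notin> S" for n k using L0 that l2_zero_outside[OF \<sigma> that] by simp
      then show ?thesis using l2I[of S "\<sigma> _ - L"] bound by blast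
    qed
    \<comment> \<open>The pointwise limit \<open>L\<close> is not yet known to be square-summable;
      it is recovered as a difference of two members of \<open>l2 S\<close>.\<close>
    obtain n where "\<sigma> n - L \<in> l2 S" using tail[of 1] by auto
    then have "\<sigma> n - (\<sigma> n - L) \<in> l2 S" by (rule l2_diff[OF \<sigma>])
    then have LS: "L \<in> l2 S" by simp
    have "limitin mtopology \<sigma> L sequentially"
      unfolding limit_metric_sequentially
    proof (intro conjI allI impI LS)
      fix \<epsilon> :: real assume "\<epsilon> > 0"
      \<comment> \<open>Halving \<epsilon> turns the weak inequality of \<open>tail\<close> into the
        strict one required for convergence.\<close>
      then obtain N where N: "\<And>n. n \<ge> N \<Longrightarrow> sqnorm (\<sigma> n - L) \<le> (\<epsilon> / 2)\<^sup>2"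
        using tail[of "\<epsilon> / 2"] by auto
      have "?d (\<sigma> n) L < \<epsilon>" if "n \<ge> N" for n
      proof -
        have "sqrt (sqnorm (\<sigma> n - L)) \<le> \<epsilon> / 2"
          using N[OF that] \<open>\<epsilon> > 0\<close> by (intro real_le_lsqrt) (auto simp: sqnorm_nonneg)
        then show ?thesis using \<open>\<epsilon> > 0\<close> l2_hdist[OF \<sigma> LS] by simp
      qed
      then show "\<exists>N. \<forall>n\<ge>N. \<sigma> n \<in> l2 S \<and> ?d (\<sigma> n) L < \<epsilon>" using \<sigma> by blast
    qed
    then show "\<exists>L. limitin mtopology \<sigma> L sequentially" by blast
  qed
qed

section \<open>Coordinate projections and the standard orthonormal basis\<close>

lemma cutoff_l2:
  assumes "f \<in> l2 S"
  shows "cutoff T f \<in> l2 (S \<inter> T)" and "sqnorm (cutoff T f) \<le> sqnorm f"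
proof -
  have z: "cutoff T f k = 0" if "k \<notin> S \<inter> T" for k
    using l2_zero_outside[OF assms] that by (auto simp: cutoff_def)
  have le: "(\<Sum>k\<in>F. (cmod (cutoff T f k))\<^sup>2) \<le> sqnorm f" if "finite F" for F
  proof -
    have "(\<Sum>k\<in>F. (cmod (cutoff T f k))\<^sup>2) \<le> (\<Sum>k\<in>F. (cmod (f k))\<^sup>2)"
      by (rule sum_mono) (simp add: cutoff_def)
    also have "\<dots> \<le> sqnorm f" using l2_finite_sum_le[OF assms that] .
    finally show ?thesis .
  qed
  show "cutoff T f \<in> l2 (S \<inter> T)" "sqnorm (cutoff T f) \<le> sqnorm f"
    using l2I[OF z le] by blast+
qed

text \<open>The range of a cutoff is again a space of this family, so its rank can be read off from
  \<open>orthonormal_basis_l2\<close>.\<close>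

lemma cutoff_image: "cutoff T ` l2 S = l2 (S \<inter> T)"
proof (intro equalityI subsetI)
  fix f assume f: "f \<in> l2 (S \<inter> T)"
  then have "cutoff T f = f" using l2_zero_outside by (fastforce simp: cutoff_def)
  moreover have "f \<in> l2 S" using f l2_mono[of "S \<inter> T" S] by blast
  ultimately show "f \<in> cutoff T ` l2 S" by (metis imageI)
qed (use cutoff_l2 in blast)

text \<open>A finite \<open>F\<close> carries all but \<epsilon> squared of the total mass, so
  enlarging it to any \<open>T\<close>, finite or not, leaves an error below \<epsilon>. The case
  \<open>T = F\<close> gives density of the span of unit vectors; larger \<open>T\<close> give
  convergence of block sums.\<close>

lemma cutoff_close:
  assumes f: "f \<in> l2 S" and "\<epsilon> > 0"
  obtains F where "finite F" "F \<subseteq> S"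
    "\<And>T. F \<subseteq> T \<Longrightarrow> l2_dist S (cutoff T f) f < \<epsilon>"
proof -
  let ?s = "\<lambda>F. \<Sum>k\<in>F. (cmod (f k))\<^sup>2"
  have "(?s \<longlongrightarrow> sqnorm f) (finite_subsets_at_top UNIV)"
    unfolding sqnorm_def by (rule infsum_tendsto) (use f in \<open>simp add: l2_def\<close>)
  moreover have "sqnorm f - \<epsilon>\<^sup>2 < sqnorm f" using \<open>\<epsilon> > 0\<close> by simp
  ultimately have "\<forall>\<^sub>F F in finite_subsets_at_top UNIV. sqnorm f - \<epsilon>\<^sup>2 < ?s F"
    by (rule order_tendstoD)
  then obtain F where F: "finite F" "sqnorm f - \<epsilon>\<^sup>2 < ?s F"
    unfolding eventually_finite_subsets_at_top by blast
  have "?s (F \<inter> S) = ?s F"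
    using F(1) l2_zero_outside[OF f] by (intro sum.mono_neutral_left) auto
  then have FS: "sqnorm f - \<epsilon>\<^sup>2 < ?s (F \<inter> S)" using F by simp
  show ?thesis
  proof (rule that)
    show "finite (F \<inter> S)" "F \<inter> S \<subseteq> S" using F by auto
    fix T assume T: "F \<inter> S \<subseteq> T"
    have cS: "cutoff T f \<in> l2 S" using cutoff_l2(1)[OF f] l2_mono[of "S \<inter> T" S] by blast
    have "(\<Sum>k\<in>G. (cmod ((cutoff T f - f) k))\<^sup>2) \<le> sqnorm f - ?s (F \<inter> S)" if G: "finite G" for G
    proof -
      \<comment> \<open>The difference vanishes on \<open>T\<close>, hence on
        \<open>F \<inter> S\<close>, and elsewhere is at most \<open>f\<close> in modulus.\<close>
      have "(\<Sum>k\<in>G. (cmod ((cutoff T f - f) k))\<^sup>2) = (\<Sum>k\<in>G - F \<inter> S. (cmod ((cutoff T f - f) k))\<^sup>2)"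
        using G T by (intro sum.mono_neutral_right) (auto simp: cutoff_def)
      also have "\<dots> \<le> ?s (G - F \<inter> S)" by (rule sum_mono) (simp add: cutoff_def)
      also have "\<dots> = ?s (G \<union> F \<inter> S) - ?s (F \<inter> S)"
        using sum.union_disjoint[of "G - F \<inter> S" "F \<inter> S" "\<lambda>k. (cmod (f k))\<^sup>2"] G F
        by (simp add: Diff_disjoint Int_commute)
      also have "\<dots> \<le> sqnorm f - ?s (F \<inter> S)"
        using l2_finite_sum_le[OF f, of "G \<union> F \<inter> S"] G F by simp
      finally show ?thesis .
    qed
    then have "sqnorm (cutoff T f - f) \<le> sqnorm f - ?s (F \<inter> S)"
      using l2I(2)[of UNIV "cutoff T f - f"] by blast
    then have "sqnorm (cutoff T f - f) < \<epsilon>\<^sup>2" using FS by linarith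
    then show "l2_dist S (cutoff T f) f < \<epsilon>"
      unfolding l2_hdist[OF cS f] using \<open>\<epsilon> > 0\<close> by (intro real_less_lsqrt) (auto simp: sqnorm_nonneg)
  qed
qed

lemma unit_fun_l2: "k \<in> S \<Longrightarrow> unit_fun k \<in> l2 S"
proof (rule l2I)
  fix F :: "'a set" assume "finite F"
  then show "(\<Sum>j\<in>F. (cmod (unit_fun k j))\<^sup>2) \<le> 1"
    by (simp add: unit_fun_def if_distrib[of cmod] if_distrib[of "\<lambda>x. x\<^sup>2"] sum.delta cong: if_cong)
qed (auto simp: unit_fun_def)

lemma l2_ip_unit_fun: "l2_ip (unit_fun j) (unit_fun k) = (if j = k then 1 else 0)"
proof -
  have "l2_ip (unit_fun j) (unit_fun k) = (\<Sum>\<^sub>\<infinity>i\<in>{j}. unit_fun j i * cnj (unit_fun k i))"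
    unfolding l2_ip_def by (rule infsum_cong_neutral) (auto simp: unit_fun_def)
  then show ?thesis by (simp add: unit_fun_def)
qed

lemma cutoff_insert:
  assumes "k \<notin> F"
  shows "cutoff (insert k F) f = cscale (f k) (unit_fun k) + cutoff F f"
  using assms by (auto simp: fun_eq_iff cutoff_def unit_fun_def)

lemma cutoff_finite_in_span: "finite F \<Longrightarrow> F \<subseteq> S \<Longrightarrow> cutoff F f \<in> cfun.span (unit_fun ` S)"
proof (induction F rule: finite_induct)
  case empty
  have "cutoff {} f = 0" by (simp add: cutoff_def fun_eq_iff)
  then show ?case by (metis cfun.span_zero)
next
  case (insert k F)
  then have "cutoff F f \<in> cfun.span (unit_fun ` S)" and "unit_fun k \<in> unit_fun ` S" by blast+
  then show ?case unfolding cutoff_insert[OF insert.hyps(2)]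
    by (intro cfun.span_add[OF cfun.span_scale[OF cfun.span_base]])
qed

text \<open>The closure is taken in the ambient \<open>l2 K\<close>. It stays inside
  \<open>l2 S\<close> because evaluation is continuous, and it exhausts \<open>l2 S\<close> because
  finite cutoffs approximate. The case \<open>S = K\<close> yields the rank of the module, smaller
  \<open>S\<close> the ranks of its projections.\<close>

lemma orthonormal_basis_l2:
  assumes "S \<subseteq> K"
  shows "complex_hilbert_space.orthonormal_basis cscale (l2 K) l2_ip (l2 S) (unit_fun ` S)"
proof -
  interpret complex_hilbert_space cscale "l2 K" l2_ip by (rule complex_hilbert_space_l2)
  interpret S: complex_inner_space cscale "l2 S" l2_ip by (rule complex_inner_space_l2)
  have SK: "l2 S \<subseteq> l2 K" using assms by (rule l2_mono)
  have base: "unit_fun ` S \<subseteq> l2 S" by (rule image_subsetI) (rule unit_fun_l2)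
  have span: "cfun.span (unit_fun ` S) \<subseteq> l2 S" using base S.subspace_H by (rule cfun.span_minimal)
  have dense: "mtopology closure_of cfun.span (unit_fun ` S) = l2 S"
    unfolding metric_closure_of
  proof (intro equalityI subsetI)
    fix f assume f: "f \<in> {x \<in> l2 K. \<forall>r>0. \<exists>y\<in>cfun.span (unit_fun ` S). y \<in> mball x r}"
    then have fK: "f \<in> l2 K" by simp
    have approx: "\<exists>y\<in>l2 S. y \<in> l2 K \<and> l2_dist K f y < r" if r: "r > 0" for r
    proof -
      obtain y where "y \<in> cfun.span (unit_fun ` S)" "y \<in> mball f r" using f r by blast
      then show ?thesis using span in_mball by blast
    qed
    have "f k = 0" if "k \<notin> S" for k
    \<comment> \<open>An approximant closer than \<open>cmod (f k)\<close> vanishes at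
      \<open>k\<close>, yet differs from \<open>f\<close> there by exactly that amount.\<close>
    proof (rule ccontr)
      assume "f k \<noteq> 0"
      then obtain y where y: "y \<in> l2 S" "y \<in> l2 K"
        "l2_dist K f y < cmod (f k)"
        using approx[of "cmod (f k)"] by auto
      then show False using norm_le_hdist[OF fK y(2), of k] l2_zero_outside[OF y(1) that] by simp
    qed
    then show "f \<in> l2 S" using fK by (simp add: l2_def)
  next
    fix f assume f: "f \<in> l2 S"
    have "\<exists>y\<in>cfun.span (unit_fun ` S). y \<in> mball f r" if r: "r > 0" for r
    proof -
      obtain F where F: "finite F" "F \<subseteq> S"
        and d: "\<And>T. F \<subseteq> T \<Longrightarrow> l2_dist S (cutoff T f) f < r"
        using cutoff_close[OF f r] by blast
      have sp: "cutoff F f \<in> cfun.span (unit_fun ` S)" using F by (rule cutoff_finite_in_span)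
      then have c: "cutoff F f \<in> l2 S" using span by blast
      \<comment> \<open>The function \<open>hdist\<close> depends on the carrier; on
        \<open>l2 S\<close> both distances are the root of \<open>sqnorm\<close> of the
        difference.\<close>
      then have "l2_dist K (cutoff F f) f < r"
        using d[of F] f c SK l2_hdist[OF c f] l2_hdist[of "cutoff F f" K f] by (simp add: subset_iff)
      then have "cutoff F f \<in> mball f r"
        using f c SK commute[of f "cutoff F f"] by auto
      then show ?thesis using sp by blast
    qed
    then show "f \<in> {x \<in> l2 K. \<forall>r>0. \<exists>y\<in>cfun.span (unit_fun ` S). y \<in> mball x r}"
      using f SK by blast
  qed
  have orth: "l2_ip u v = (if u = v then 1 else 0)" if "u \<in> unit_fun ` S" "v \<in> unit_fun ` S" for u v
  proof -
    from that obtain j k where "u = unit_fun j" "v = unit_fun k" by blast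
    then show ?thesis using l2_ip_unit_fun[of j k] inj_eq[OF inj_unit_fun, of j k] by simp
  qed
  show ?thesis unfolding orthonormal_basis_def by (intro conjI ballI base orth dense)
qed

lemma projection_cutoff: "complex_hilbert_space.projection cscale (l2 K) l2_ip (cutoff T)"
proof -
  interpret complex_hilbert_space cscale "l2 K" l2_ip by (rule complex_hilbert_space_l2)
  have closed: "cutoff T v \<in> l2 K" if "v \<in> l2 K" for v
    using cutoff_l2(1)[OF that, of T] l2_mono[of "K \<inter> T" K] by blast
  have add: "cutoff T (u + v) = cutoff T u + cutoff T v" for u v :: "'a \<Rightarrow> complex"
    by (simp add: cutoff_def fun_eq_iff)
  have scale: "cutoff T (cscale c v) = cscale c (cutoff T v)" for c and v :: "'a \<Rightarrow> complex"
    by (simp add: cutoff_def fun_eq_iff)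
  have norm: "hnorm (cutoff T v) \<le> 1 * hnorm v" if "v \<in> l2 K" for v
    using cutoff_l2(2)[OF that, of T] by (simp add: l2_hnorm[OF that] l2_hnorm[OF closed[OF that]])
  have idem: "cutoff T (cutoff T v) = cutoff T v" for v :: "'a \<Rightarrow> complex"
    by (simp add: cutoff_def fun_eq_iff)
  have adj: "l2_ip (cutoff T u) v = l2_ip u (cutoff T v)" for u v :: "'a \<Rightarrow> complex"
    unfolding l2_ip_def by (rule infsum_cong) (simp add: cutoff_def)
  have "bounded_operator (cutoff T)" unfolding bounded_operator_def
  proof (intro conjI exI[of _ 1] ballI allI)
    show "cutoff T \<in> l2 K \<rightarrow> l2 K" using closed by (rule Pi_I)
  qed (rule add scale norm | assumption)+
  then show ?thesis unfolding projection_def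
    by (intro conjI ballI) (rule idem adj | assumption)+
qed

lemma cutoff_Union:
  assumes "finite Q" "disjoint Q"
  shows "(\<Sum>A\<in>Q. cutoff (t -` A) v) = cutoff (t -` \<Union>Q) v"
  using assms
proof (induction Q rule: finite_induct)
  case empty
  show ?case by (simp add: cutoff_def fun_eq_iff)
next
  case (insert A Q)
  have "A \<inter> \<Union>Q = {}" using insert.prems insert.hyps by (fastforce simp: disjoint_def)
  then have "cutoff (t -` \<Union>(insert A Q)) v = cutoff (t -` A) v + cutoff (t -` \<Union>Q) v"
    by (auto simp: cutoff_def fun_eq_iff)
  moreover have "disjoint Q" using insert.prems by (simp add: disjoint_def)
  ultimately show ?case using insert by simp
qed

text \<open>A finite block sum is the cutoff to the preimage of the union of these blocks. As soon
  as the blocks include those containing the \<open>t\<close>-images of the finite set from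
  \<open>cutoff_close\<close>, the error is below \<epsilon>.\<close>

lemma sum_cutoff_blocks_limit:
  assumes t: "t \<in> K \<rightarrow> X" and P: "partition_on X P" and v: "v \<in> l2 K"
  shows "limitin (Metric_space.mtopology (l2 K) (l2_dist K))
    (\<lambda>F. \<Sum>A\<in>F. cutoff (t -` A) v) v (finite_subsets_at_top P)"
proof -
  interpret complex_hilbert_space cscale "l2 K" l2_ip by (rule complex_hilbert_space_l2)
  have disj: "disjoint P" and cover: "\<Union>P = X" using P by (auto simp: partition_on_def)
  show ?thesis unfolding limitin_metric
  proof (intro conjI allI impI v)
    fix \<epsilon> :: real assume "\<epsilon> > 0"
    then obtain F where F: "finite F" "F \<subseteq> K"
      and close: "\<And>T. F \<subseteq> T \<Longrightarrow> l2_dist K (cutoff T v) v < \<epsilon>"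
      using cutoff_close[OF v] by blast
    have "\<exists>A. A \<in> P \<and> t k \<in> A" if "k \<in> F" for k using t F(2) cover that by blast
    then obtain B where B: "\<And>k. k \<in> F \<Longrightarrow> B k \<in> P \<and> t k \<in> B k" by metis
    have "(\<Sum>A\<in>Q. cutoff (t -` A) v) \<in> l2 K \<and> hdist (\<Sum>A\<in>Q. cutoff (t -` A) v) v < \<epsilon>"
      if Q: "finite Q" "B ` F \<subseteq> Q" "Q \<subseteq> P" for Q
    proof -
      have "disjoint Q" using disj Q(3) unfolding disjoint_def by blast
      then have "(\<Sum>A\<in>Q. cutoff (t -` A) v) = cutoff (t -` \<Union>Q) v" by (rule cutoff_Union[OF Q(1)])
      moreover have "F \<subseteq> t -` \<Union>Q" using B Q(2) by blast
      moreover have "cutoff (t -` \<Union>Q) v \<in> l2 K"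
        using cutoff_l2(1)[OF v, of "t -` \<Union>Q"] l2_mono[of "K \<inter> t -` \<Union>Q" K] by blast
      ultimately show ?thesis using close by simp
    qed
    moreover have "finite (B ` F)" "B ` F \<subseteq> P" using F(1) B by auto
    ultimately show "\<forall>\<^sub>F Q in finite_subsets_at_top P. (\<Sum>A\<in>Q. cutoff (t -` A) v) \<in> l2 K \<and>
        hdist (\<Sum>A\<in>Q. cutoff (t -` A) v) v < \<epsilon>"
      unfolding eventually_finite_subsets_at_top by (intro exI[of _ "B ` F"]) blast
  qed
qed

section \<open>Modules of square-summable functions\<close>

context coarse_space
begin

lemma gauge_rel_Id_on: "gauge_rel (Id_on X)"
  by (auto simp: gauge_rel_def diagonal sym_def)

lemma coarsely_dense_mono:
  assumes "coarsely_dense D" "D \<subseteq> D'" "D' \<subseteq> X"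
  shows "coarsely_dense D'"
proof -
  from assms(1) have "\<exists>E\<in>\<E>. X = E\<inverse> `` D" unfolding coarsely_dense_def by (rule conjunct2)
  then obtain E where E: "E \<in> \<E>" and X: "X = E\<inverse> `` D" by (rule bexE)
  have "X = E\<inverse> `` D'"
  proof (rule equalityI)
    show "X \<subseteq> E\<inverse> `` D'" using equalityD1[OF X] Image_mono[OF subset_refl assms(2)] by (rule subset_trans)
    show "E\<inverse> `` D' \<subseteq> X" using on_carrier[OF E] by blast
  qed
  with E assms(3) show ?thesis unfolding coarsely_dense_def by (intro conjI bexI)
qed

text \<open>The basis vector indexed by \<open>k\<close> is placed at the point \<open>t k\<close>, so that every subset of \<open>X\<close>
  is measurable.\<close>

lemma coarse_module_l2:
  assumes t: "t \<in> K \<rightarrow> X"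
  shows "coarse_module X \<E> cscale (l2 K) l2_ip (Pow X) (\<lambda>A. cutoff (t -` A))"
proof (intro coarse_module.intro coarse_space_axioms complex_hilbert_space_l2 coarse_module_axioms.intro)
  interpret complex_hilbert_space cscale "l2 K" l2_ip by (rule complex_hilbert_space_l2)
  show "algebra X (Pow X)" by (rule algebra_Pow)
  show "projection (cutoff (t -` A))" for A by (rule projection_cutoff)
  show "cutoff (t -` {}) v = 0" for v by (simp add: cutoff_def fun_eq_iff)
  show "cutoff (t -` X) v = v" if "v \<in> l2 K" for v
    using t l2_zero_outside[OF that] by (fastforce simp: cutoff_def fun_eq_iff)
  show "cutoff (t -` (A \<inter> B)) v = cutoff (t -` A) (cutoff (t -` B) v)" for A B v
    by (auto simp: cutoff_def fun_eq_iff)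
  show "cutoff (t -` (A \<union> B)) v =
      cutoff (t -` A) v + cutoff (t -` B) v - cutoff (t -` A) (cutoff (t -` B) v)" for A B v
    by (auto simp: cutoff_def fun_eq_iff)
  \<comment> \<open>Non-degeneracy holds already for the diagonal gauge: the unit vector at
    \<open>k\<close> lies in the range of the projection of the singleton
    \<open>{t k}\<close>.\<close>
  let ?S = "\<Union>A\<in>{A \<in> Pow X. rel_bounded (Id_on X) A}. cutoff (t -` A) ` l2 K"
  have sub: "unit_fun ` K \<subseteq> ?S"
  proof (rule image_subsetI)
    fix k assume k: "k \<in> K"
    have "cutoff (t -` {t k}) (unit_fun k) = unit_fun k"
      by (auto simp: cutoff_def unit_fun_def fun_eq_iff)
    then have "unit_fun k \<in> cutoff (t -` {t k}) ` l2 K" using unit_fun_l2[OF k] by (metis imageI)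
    moreover have "{t k} \<in> {A \<in> Pow X. rel_bounded (Id_on X) A}"
      using t k by (auto simp: rel_bounded_def)
    ultimately show "unit_fun k \<in> ?S" by blast
  qed
  have "mtopology closure_of cfun.span (unit_fun ` K) = l2 K"
    using orthonormal_basis_l2[of K K] by (simp add: orthonormal_basis_def)
  then have "l2 K \<subseteq> mtopology closure_of cfun.span ?S"
    using closure_of_mono[OF cfun.span_mono[OF sub], of mtopology] by simp
  moreover have "mtopology closure_of cfun.span ?S \<subseteq> l2 K"
    using closure_of_subset_topspace[of mtopology] by simp
  ultimately have "mtopology closure_of cfun.span ?S = l2 K" by (intro equalityI)
  then show "\<exists>E. gauge_rel E \<and> mtopology closure_of
      cfun.span (\<Union>A\<in>{A \<in> Pow X. rel_bounded E A}. cutoff (t -` A) ` l2 K) = l2 K"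
    using gauge_rel_Id_on by (intro exI[of _ "Id_on X"] conjI)
qed

text \<open>Ampleness is tested with the diagonal gauge, whose nonempty bounded sets are singletons;
  a nonzero one is a value of \<open>t\<close>, and its rank is the size of a fibre. Discreteness
  uses the separate gauge \<open>E\<close>, and its gluing condition holds since every subset of
  \<open>X\<close> is measurable.\<close>

lemma roe_like_algebras_defined_l2:
  fixes \<kappa> :: "'k rel" and t :: "'k \<Rightarrow> 'a"
  assumes \<kappa>: "Card_order \<kappa>" and t: "t \<in> Field \<kappa> \<rightarrow> X"
    and fibres: "\<And>k. k \<in> Field \<kappa> \<Longrightarrow> \<kappa> \<le>o |{j \<in> Field \<kappa>. t j = t k}|"
    and dense: "coarsely_dense (t ` Field \<kappa>)"
    and E: "gauge_rel E" and P: "partition_on X P" "\<And>A. A \<in> P \<Longrightarrow> rel_bounded E A"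
  shows "roe_like_algebras_defined TYPE('k \<Rightarrow> complex) \<kappa> X \<E>"
proof -
  let ?K = "Field \<kappa>" and ?p = "\<lambda>A. cutoff (t -` A) :: ('k \<Rightarrow> complex) \<Rightarrow> _"
  interpret coarse_module X \<E> cscale "l2 ?K" l2_ip "Pow X" ?p
    using t by (rule coarse_module_l2)
  have card: "|unit_fun ` S| =o |S|" for S :: "'k set"
    by (rule ordIso_symmetric, rule card_of_ordIsoI[of unit_fun])
      (meson bij_betw_imageI inj_on_subset inj_unit_fun subset_UNIV)
  have "ample \<kappa>" unfolding ample_def
  proof (intro exI[of _ "Id_on X"] conjI ballI gauge_rel_Id_on)
    have "t k \<in> \<Union>(nonzero_bounded (Id_on X))" if k: "k \<in> ?K" for k
    proof -
      have "?p {t k} (unit_fun k) k = 1" by (simp add: cutoff_def unit_fun_def)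
      then have "?p {t k} (unit_fun k) \<noteq> 0" by (metis zero_fun_apply zero_neq_one)
      then have "{t k} \<in> nonzero_bounded (Id_on X)"
        using unit_fun_l2[OF k] t k by (auto simp: nonzero_bounded_def rel_bounded_def)
      then show ?thesis by blast
    qed
    then show "coarsely_dense (\<Union>(nonzero_bounded (Id_on X)))"
      by (intro coarsely_dense_mono[OF dense]) (auto simp: nonzero_bounded_def)
    fix A assume "A \<in> nonzero_bounded (Id_on X)"
    then obtain v where v: "v \<in> l2 ?K" "?p A v \<noteq> 0" by (auto simp: nonzero_bounded_def)
    \<comment> \<open>A nonzero coordinate \<open>k\<close> of the image has \<open>t k\<close> in
      \<open>A\<close>, so the whole fibre of \<open>t\<close> through \<open>k\<close> contributes
      basis vectors.\<close>
    from v(2) obtain k where "?p A v k \<noteq> 0" by (auto simp: fun_eq_iff)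
    then have k: "k \<in> ?K" "t k \<in> A" using l2_zero_outside[OF v(1)] by (auto simp: cutoff_def split: if_splits)
    let ?S = "?K \<inter> t -` A"
    have "\<kappa> \<le>o |{j \<in> ?K. t j = t k}|" using fibres[OF k(1)] .
    also have "|{j \<in> ?K. t j = t k}| \<le>o |?S|" using k by (intro card_of_mono1) auto
    also have "|?S| =o |unit_fun ` ?S :: ('k \<Rightarrow> complex) set|" using card by (rule ordIso_symmetric)
    finally have "\<kappa> \<le>o |unit_fun ` ?S :: ('k \<Rightarrow> complex) set|" .
    then show "has_rank_at_least (?p A ` l2 ?K) \<kappa>"
      unfolding has_rank_at_least_def cutoff_image
      using orthonormal_basis_l2[of ?S ?K] by blast
  qed
  moreover have "discrete" unfolding discrete_def
    using E P sum_cutoff_blocks_limit[OF t P(1)]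
    by (intro exI[of _ E] exI[of _ P] conjI ballI allI impI) (auto simp: partition_on_def)
  moreover have "has_rank (l2 ?K) \<kappa>"
    unfolding has_rank_def
  proof (intro exI conjI)
    show "orthonormal_basis (l2 ?K) (unit_fun ` ?K)" by (rule orthonormal_basis_l2) simp
    show "|unit_fun ` ?K :: ('k \<Rightarrow> complex) set| =o \<kappa>"
      using card card_of_Field_ordIso[OF \<kappa>] by (rule ordIso_transitive)
  qed
  ultimately show ?thesis
    unfolding roe_like_algebras_defined_def using coarse_module_axioms by blast
qed

text \<open>Since \<kappa> is infinite and \<open>I\<close> is nonempty of size at most \<kappa>,
  the product \<open>I \<times> Field \<kappa>\<close> has size \<kappa>. A bijection onto it
  followed by \<open>fst\<close> has fibres that are copies of
  \<open>Field \<kappa>\<close>.\<close>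

lemma surjection_with_large_fibres:
  assumes "Cinfinite \<kappa>" and "I \<noteq> {}" and "|I| \<le>o \<kappa>"
  obtains t where "t ` Field \<kappa> = I" "\<And>i. i \<in> I \<Longrightarrow> \<kappa> \<le>o |{k \<in> Field \<kappa>. t k = i}|"
proof -
  let ?K = "Field \<kappa>"
  have inf: "infinite ?K" and \<kappa>: "|?K| =o \<kappa>"
    using assms(1) card_of_Field_ordIso by (auto simp: cinfinite_def)
  have "|I| \<le>o |?K|" using assms(3) ordIso_symmetric[OF \<kappa>] by (rule ordLeq_ordIso_trans)
  then have "|?K| =o |I \<times> ?K|" using inf assms(2) by (intro card_of_Times_infinite_simps)
  then obtain f where f: "bij_betw f ?K (I \<times> ?K)" using card_of_ordIso[of ?K "I \<times> ?K"] by blast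
  show ?thesis
  proof (rule that[of "fst \<circ> f"])
    have "(fst \<circ> f) ` ?K = fst ` (I \<times> ?K)" using f by (metis bij_betw_imp_surj_on image_comp)
    also have "\<dots> = I" using inf by force
    finally show "(fst \<circ> f) ` ?K = I" .
    fix i assume i: "i \<in> I"
    let ?g = "\<lambda>k. inv_into ?K f (i, k)"
    have g: "f (?g k) = (i, k)" "?g k \<in> ?K" if "k \<in> ?K" for k
      using f i that by (auto simp: bij_betw_def f_inv_into_f inv_into_into)
    have "inj_on ?g ?K" by (rule inj_onI) (metis g(1) prod.inject)
    moreover have "?g ` ?K \<subseteq> {k \<in> ?K. (fst \<circ> f) k = i}" using g by auto
    ultimately have "|?K| \<le>o |{k \<in> ?K. (fst \<circ> f) k = i}|" using card_of_ordLeqI by blast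
    then show "\<kappa> \<le>o |{k \<in> ?K. (fst \<circ> f) k = i}|"
      using ordIso_symmetric[OF \<kappa>] by (rule ordIso_ordLeq_trans[rotated])
  qed
qed

text \<open>The composite \<open>h\<close> of the two maps of a coarse equivalence factors through
  the small set \<open>Y\<close> and is close to the identity. Hence its image is small and coarsely
  dense, and its fibres are uniformly bounded.\<close>

lemma roe_like_algebras_defined_if_coarse_cardinality_le:
  fixes \<kappa> :: "'k rel"
  assumes \<kappa>: "Cinfinite \<kappa>" and "X \<noteq> {}" and le: "coarse_cardinality X \<E> \<le>o \<kappa>"
  shows "roe_like_algebras_defined TYPE('k \<Rightarrow> complex) \<kappa> X \<E>"
proof -
  obtain Y :: "'a set" and \<F> where eq: "coarsely_equivalent X \<E> Y \<F>" and Y: "coarse_cardinality X \<E> = |Y|"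
    using coarse_cardinality_attained[OF coarse_space_axioms] by blast
  obtain f g where f: "f \<in> X \<rightarrow> Y" and g: "g \<in> Y \<rightarrow> X" and close: "{(g (f x), x) | x. x \<in> X} \<in> \<E>"
    using eq unfolding coarsely_equivalent_def by blast
  define h where "h = g \<circ> f"
  define G where "G = {(h x, x) | x. x \<in> X}"
  have G: "G \<in> \<E>" using close by (simp add: G_def h_def)
  have hX: "h ` X \<subseteq> X" using f g by (auto simp: h_def)
  have "|h ` X| \<le>o |Y|"
    using f card_of_image[of g Y] card_of_mono1[of "h ` X" "g ` Y"] ordLeq_transitive
    by (fastforce simp: h_def)
  then have hX\<kappa>: "|h ` X| \<le>o \<kappa>" using le unfolding Y by (rule ordLeq_transitive)
  \<comment> \<open>Here \<open>X \<noteq> {}\<close> enters: the infinite set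
    \<open>Field \<kappa>\<close> has no map into an empty set.\<close>
  have "h ` X \<noteq> {}" using \<open>X \<noteq> {}\<close> by simp
  then obtain t where t: "t ` Field \<kappa> = h ` X"
    and fibres: "\<And>i. i \<in> h ` X \<Longrightarrow> \<kappa> \<le>o |{k \<in> Field \<kappa>. t k = i}|"
    using hX\<kappa> by (rule surjection_with_large_fibres[OF \<kappa>]) blast
  \<comment> \<open>This is the kernel relation of \<open>h\<close>, with \<open>P\<close> its
    classes. It is controlled because related points are joined through their common value under
    \<open>h\<close>.\<close>
  define E where "E = {(x, y). x \<in> X \<and> y \<in> X \<and> h x = h y}"
  define P where "P = (\<lambda>i. X \<inter> h -` {i}) ` h ` X"
  have "E \<subseteq> G\<inverse> O G" by (auto simp: E_def G_def)
  then have "E \<in> \<E>" using subset_closed[OF relcomp_closed[OF converse_closed[OF G] G]] by blast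
  then have gauge: "gauge_rel E" by (auto simp: gauge_rel_def E_def sym_def)
  show ?thesis
  proof (rule roe_like_algebras_defined_l2[OF _ _ _ _ gauge])
    show "Card_order \<kappa>" using \<kappa> by simp
    show "t \<in> Field \<kappa> \<rightarrow> X" using t hX by blast
    show "\<kappa> \<le>o |{j \<in> Field \<kappa>. t j = t k}|" if "k \<in> Field \<kappa>" for k using fibres t that by blast
    \<comment> \<open>The pairs in \<open>G\<close> have the \<open>h\<close>-value first, whereas
      \<open>coarsely_dense\<close> expects the point of the dense set second; so the witness is the
      converse of \<open>G\<close>.\<close>
    have "X = (G\<inverse>)\<inverse> `` (h ` X)" by (auto simp: G_def)
    then show "coarsely_dense (t ` Field \<kappa>)"
      unfolding coarsely_dense_def t using hX converse_closed[OF G] by (intro conjI bexI)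
    show "partition_on X P"
      by (auto simp: partition_on_def disjoint_def P_def)
    show "rel_bounded E A" if "A \<in> P" for A
      using that by (auto simp: rel_bounded_def P_def E_def)
  qed
qed

end

text \<open>The Hilbert space must live in a fixed type, and \<open>'k \<Rightarrow> complex\<close>
  is large enough for existence. The second conjunct shows that a module in any other ambient type
  forces the same bound.\<close>

theorem corollary8p11:
  fixes \<kappa> :: "'k rel" and X :: "'a set" and \<E> :: "('a \<times> 'a) set set"
  assumes "Cinfinite \<kappa>"
    and "coarse_space X \<E>"
    and "X \<noteq> {}"
  shows "(roe_like_algebras_defined TYPE('k \<Rightarrow> complex) \<kappa> X \<E> \<longleftrightarrow>
            coarse_cardinality X \<E> \<le>o \<kappa>) \<and>
         (roe_like_algebras_defined TYPE('v :: ab_group_add) \<kappa> X \<E> \<longrightarrow>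
            coarse_cardinality X \<E> \<le>o \<kappa>)"
proof -
  interpret coarse_space X \<E> by fact
  show ?thesis
    using roe_like_algebras_defined_if_coarse_cardinality_le[OF assms(1,3)]
      coarse_cardinality_le_if_roe_like_algebras_defined[OF assms(1), where ?'v = "'k \<Rightarrow> complex"]
      coarse_cardinality_le_if_roe_like_algebras_defined[OF assms(1), where ?'v = 'v]
    by blast
qed

end
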